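(* Let $F$ be a probability distribution on $\mathbb{R}^d$ with a Lebesgue density, $G$ a probability distribution on $\mathbb{R}$, and let $(x,u)\in\mathbb{R}^d\times S^{d-1}$ be fixed. In parts (a)–(c) assume that both $F$ and $G$ have positive Lebesgue densities $f$ and $g$, respectively. (a) With $I_{x,u}(q_{x,u}(\delta))=[s^l_{x,u}(\delta),s^r_{x,u}(\delta)]$, $\delta\in(0,1)$, we have $$q_{x,u}(\delta)=d_{x,u}(s^l_{x,u}(\delta))=d_{x,u}(s^r_{x,u}(\delta)).$$ Moreover, $q_{x,u}(\delta)$ is strictly increasing with $q_{x,u}(0)=0$, and if $g$ is symmetric about zero then $q_{x,u}(\delta)=q_{x,-u}(\delta)$ for all $\delta\in[0,1]$. (b) (large scales) $q_{x,u}(1)=\min\big(F_{x,u}(x),1-F_{x,u}(x)\big)$ is the global Tukey depth of $x$ for the distribution with cdf $F_{x,u}(t)$. (c) (small scales) $\displaystyle\lim_{\delta\to0}\frac{q_{x,u}(\delta)}{\delta^d}=c_d\,\frac{f(x)}{g^d(0)}$, where $c_d>0$ is a known constant. (d) (invariance) Let $\theta=(\mu,\sigma,O)$ with $\mu\in\mathbb{R}^d$, $\sigma>0$, $O\in\mathbb{R}^{d\times d}$ orthogonal, let $F_\theta(t)=F\big(\tfrac{O^{-1}(t-\mu)}{\sigma}\big)$, $t\in\mathbb{R}^d$, and let $G_\theta(t)=G\big(\tfrac{t}{\sigma}\big)$. If $q^{\theta}_{x,u}(\delta)$ denotes the depth quantile function defined with $G_\theta$ and $F_\theta$, while $q_{x,u}(\delta)$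 is the one for $F$ (and $G$), then, for any $\theta$, $$q^{\theta}_{\sigma Ox+\mu,\,Ou}(\delta)=q_{x,u}(\delta).$$
   Context: Let $d\ge 2$ and fix an opening angle $\alpha\in[0,\pi)$. In slight abuse of notation, $F(t)$ with $t\in\mathbb{R}^d$ also denotes the distribution function corresponding to the distribution $F$, and similarly for other distributions. For $x\in\mathbb{R}^d$, $u\in S^{d-1}$ (unit sphere) and $s\in\mathbb{R}$, $C_{x,u}(s)$ is the closed (infinite, solid) right spherical cone with opening angle $\alpha$ (angle $\alpha/2$ between axis and boundary), axis of symmetry $\ell_{x,u}=\{x+tu: t\in\mathbb{R}\}$ and tip $y=x+su$, oriented so that it contains $x$: for $s\ge 0$ it is $\{z:\langle z-y,-u\rangle\ge\cos(\alpha/2)\|z-y\|\}$, and for $s<0$ it is $\{z:\langle z-y,u\rangle\ge\cos(\alpha/2)\|z-y\|\}$. The hyperplane $\{z:\langle z-x,u\rangle=0\}$ splits $C_{x,u}(s)$ into two closed sets: $A_{x,u}(s)$, the part on the side of the tip, and $B_{x,u}(s)$, the remaining frustum. That is, for $s\ge0$, $A_{x,u}(s)=C_{x,u}(s)\cap\{z:\langle z-x,u\rangle\ge 0\}$ and $B_{x,u}(s)=C_{x,u}(s)\cap\{z:\langle z-x,u\rangle\le 0\}$; for $s<0$ the two half-spaces are interchanged. The depth function of $F$ is $d_{x,u}(s)=\min\big(F(A_{x,u}(s)),F(B_{x,u}(s))\big)$, with sublevel sets $I_{x,u}(t)=\{s\in\mathbb{R}:d_{x,u}(s)\le t\}$.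 The depth quantile function (defined with $F$ and $G$) is $$q_{x,u}(\delta)=\inf\{t\ge0: G(\{s:d_{x,u}(s)\le t\})\ge\delta\},\qquad \delta\in[0,1].$$ $F_{x,u}$ denotes the cdf of the one-dimensional distribution obtained by projecting all the mass of $F$ onto the line $\ell_{x,u}$; $F_{x,u}(x)$ is its value at the position of $x$ on the line, i.e. $P(\langle X-x,u\rangle\le0)$ for $X\sim F$.
   Formalization: The interval and strict-increase claims in (a), the value of q(1) in (b) and c_d>0 are stated for α>0 (q vanishes at α=0); (c) assumes x and 0 are Lebesgue points of f and g; in (d) F_θ is read as the law of σOX+μ, as the cdf formula fails for general O. *)

theory Defs
  imports "HOL-Probability.Probability"
begin

text \<open>The opening angle is \<open>\<alpha>\<close>; the definitions make sense in any Euclidean space. The direction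
  \<open>u\<close> is meant to be a unit vector.\<close>

definition cone :: "real \<Rightarrow> 'a::euclidean_space \<Rightarrow> 'a \<Rightarrow> real \<Rightarrow> 'a set" where
  "cone \<alpha> x u s =
     (let y = x + s *\<^sub>R u in
      if s \<ge> 0 then {z. inner (z - y) (- u) \<ge> cos (\<alpha> / 2) * norm (z - y)}
               else {z. inner (z - y) u \<ge> cos (\<alpha> / 2) * norm (z - y)})"

definition cone_A :: "real \<Rightarrow> 'a::euclidean_space \<Rightarrow> 'a \<Rightarrow> real \<Rightarrow> 'a set" where
  "cone_A \<alpha> x u s = cone \<alpha> x u s \<inter>
     (if s \<ge> 0 then {z. inner (z - x) u \<ge> 0} else {z. inner (z - x) u \<le> 0})"

definition cone_B :: "real \<Rightarrow> 'a::euclidean_space \<Rightarrow> 'a \<Rightarrow> real \<Rightarrow> 'a set" where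
  "cone_B \<alpha> x u s = cone \<alpha> x u s \<inter>
     (if s \<ge> 0 then {z. inner (z - x) u \<le> 0} else {z. inner (z - x) u \<ge> 0})"

definition depth_fun ::
    "real \<Rightarrow> 'a::euclidean_space measure \<Rightarrow> 'a \<Rightarrow> 'a \<Rightarrow> real \<Rightarrow> real" where
  "depth_fun \<alpha> F x u s =
     min (measure F (cone_A \<alpha> x u s)) (measure F (cone_B \<alpha> x u s))"

definition depth_sublevel ::
    "real \<Rightarrow> 'a::euclidean_space measure \<Rightarrow> 'a \<Rightarrow> 'a \<Rightarrow> real \<Rightarrow> real set" where
  "depth_sublevel \<alpha> F x u t = {s. depth_fun \<alpha> F x u s \<le> t}"

definition depth_quantile ::
    "real \<Rightarrow> 'a::euclidean_space measure \<Rightarrow> real measure \<Rightarrow> 'a \<Rightarrow> 'a \<Rightarrow> real \<Rightarrow> real" where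
  "depth_quantile \<alpha> F G x u \<delta> =
     Inf {t. t \<ge> 0 \<and> measure G (depth_sublevel \<alpha> F x u t) \<ge> \<delta>}"

text \<open>The projection of \<open>F\<close> onto the line through \<open>x\<close> with direction \<open>u\<close>, in the coordinate \<open>t\<close> of
  the point \<open>x + t *\<^sub>R u\<close>. The point \<open>x\<close> has coordinate \<open>0\<close>, so the value of the projected cdf
  at the position of \<open>x\<close> is \<open>cdf (line_proj F x u) 0\<close>.\<close>

definition line_proj :: "'a::euclidean_space measure \<Rightarrow> 'a \<Rightarrow> 'a \<Rightarrow> real measure" where
  "line_proj F x u = distr F borel (\<lambda>z. inner (z - x) u)"

text \<open>Tukey's half-space depth. On the real line the unit vectors are \<open>1\<close> and \<open>- 1\<close>, so it is the
  smaller of the masses of the two closed half-lines ending at \<open>p\<close>.\<close>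

definition tukey_depth :: "'a::euclidean_space measure \<Rightarrow> 'a \<Rightarrow> real" where
  "tukey_depth P p = (INF v\<in>sphere 0 1. measure P {z. inner (z - p) v \<ge> 0})"

text \<open>The volume of a solid cone of height \<open>1\<close> and opening angle \<open>\<alpha>\<close> in dimension \<open>d\<close> is
  \<open>unit_ball_vol (d - 1) * tan (\<alpha> / 2) ^ (d - 1) / d\<close>. The factor \<open>2 ^ d\<close> arises because, at
  small scales, a tip at distance \<open>h\<close> from \<open>x\<close> corresponds to an interval of length \<open>2 * h\<close>.\<close>

definition small_scale_const :: "real \<Rightarrow> nat \<Rightarrow> real" where
  "small_scale_const \<alpha> d =
     unit_ball_vol (real (d - 1)) * tan (\<alpha> / 2) ^ (d - 1) / (real d * 2 ^ d)"

text \<open>Densities are determined only up to null sets. Pointwise values of a density are meaningful at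
  its Lebesgue points: almost every point, and in particular every point of continuity.\<close>

definition lebesgue_point :: "('a::euclidean_space \<Rightarrow> real) \<Rightarrow> 'a \<Rightarrow> bool" where
  "lebesgue_point h x \<longleftrightarrow>
     ((\<lambda>r. (LINT y:ball x r|lborel. \<bar>h y - h x\<bar>) / measure lborel (ball x r)) \<longlongrightarrow> 0) (at_right 0)"

lemma isCont_imp_lebesgue_point:
  fixes h :: "'a::euclidean_space \<Rightarrow> real"
  assumes "h \<in> borel_measurable borel" and "isCont h x"
  shows "lebesgue_point h x"
  unfolding lebesgue_point_def
proof (rule tendstoI)
  fix e :: real assume "e > 0"
  then have "e / 2 > 0" by simp
  then obtain d where d: "d > 0" "\<And>y. dist y x < d \<Longrightarrow> \<bar>h y - h x\<bar> < e / 2"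
    using assms(2) unfolding continuous_at_eps_delta dist_real_def by blast
  have "dist ((LINT y:ball x r|lborel. \<bar>h y - h x\<bar>) / measure lborel (ball x r)) 0 < e"
    if r: "0 < r" "r < d" for r
  proof -
    have fin: "emeasure lborel (ball x r) < \<infinity>" using emeasure_bounded_finite[OF bounded_ball] by simp
    have const: "set_integrable lborel (ball x r) (\<lambda>_. e / 2)"
      using fin unfolding set_integrable_def by (intro integrable_scaleR_left integrable_real_indicator) auto
    have b: "\<bar>h y - h x\<bar> \<le> e / 2" if "y \<in> ball x r" for y
      using that r d(2)[of y] by (auto simp: dist_commute)
    have int: "set_integrable lborel (ball x r) (\<lambda>y. \<bar>h y - h x\<bar>)"
    proof (rule set_integrable_bound[OF const])
      show "set_borel_measurable lborel (ball x r) (\<lambda>y. \<bar>h y - h x\<bar>)"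
        unfolding set_borel_measurable_def measurable_lborel2
        by (intro borel_measurable_scaleR borel_measurable_indicator borel_measurable_abs
            borel_measurable_diff assms(1) borel_measurable_const) simp
    qed (use b \<open>e > 0\<close> in auto)
    have "(LINT y:ball x r|lborel. \<bar>h y - h x\<bar>) \<le> (LINT y:ball x r|lborel. e / 2)"
      by (rule set_integral_mono[OF int const b])
    also have "\<dots> = measure lborel (ball x r) * (e / 2)"
      using fin by (simp add: set_lebesgue_integral_def)
    finally have up: "(LINT y:ball x r|lborel. \<bar>h y - h x\<bar>) \<le> measure lborel (ball x r) * (e / 2)" .
    have pos: "measure lborel (ball x r) > 0"
      using content_ball_pos[of r x] r by (simp add: measure_def)
    have "(LINT y:ball x r|lborel. \<bar>h y - h x\<bar>) \<ge> 0"
      unfolding set_lebesgue_integral_def by (rule integral_nonneg_AE) auto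
    then have "(LINT y:ball x r|lborel. \<bar>h y - h x\<bar>) / measure lborel (ball x r) \<ge> 0"
      using pos by simp
    moreover have "(LINT y:ball x r|lborel. \<bar>h y - h x\<bar>) / measure lborel (ball x r) \<le> e / 2"
      using up pos by (simp only: pos_divide_le_eq mult.commute)
    ultimately show ?thesis using \<open>e > 0\<close> unfolding dist_real_def by linarith
  qed
  then show "\<forall>\<^sub>F r in at_right 0.
      dist ((LINT y:ball x r|lborel. \<bar>h y - h x\<bar>) / measure lborel (ball x r)) 0 < e"
    unfolding eventually_at_right_field using d(1) by auto
qed

text \<open>The transformed distributions are the laws of \<open>\<sigma> *\<^sub>R (Q *v X) + \<mu>\<close> and \<open>\<sigma> * S\<close> for
  \<open>X\<close> and \<open>S\<close> distributed according to \<open>F\<close> and \<open>G\<close>. For \<open>F\<close>, the formula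
  \<open>F (Q\<^sup>-\<^sup>1 (t - \<mu>) / \<sigma>)\<close> is to be read as an identity of set functions, since for general
  \<open>Q\<close> it does not define a cdf when \<open>F\<close> is read as one.\<close>

definition similarity_law ::
    "real ^ 'n \<Rightarrow> real \<Rightarrow> real ^ 'n ^ 'n \<Rightarrow> (real ^ 'n) measure \<Rightarrow> (real ^ 'n) measure" where
  "similarity_law \<mu> \<sigma> Q F = distr F borel (\<lambda>y. \<sigma> *\<^sub>R (Q *v y) + \<mu>)"

definition scaled_law :: "real \<Rightarrow> real measure \<Rightarrow> real measure" where
  "scaled_law \<sigma> G = distr G borel (\<lambda>s. \<sigma> * s)"

lemma measure_similarity_law:
  assumes "sets F = sets borel" and "\<sigma> > 0" and "orthogonal_matrix Q" and "S \<in> sets borel"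
  shows "measure (similarity_law \<mu> \<sigma> Q F) S =
    measure F ((\<lambda>t. (matrix_inv Q *v (t - \<mu>)) /\<^sub>R \<sigma>) ` S)"
proof -
  have inv: "matrix_inv Q ** Q = mat 1" "Q ** matrix_inv Q = mat 1"
    using assms(3) someI_ex[of "\<lambda>R. Q ** R = mat 1 \<and> R ** Q = mat 1"]
    unfolding matrix_inv_def orthogonal_matrix_def by blast+
  have [simp]: "matrix_inv Q *v (Q *v v) = v" "Q *v (matrix_inv Q *v v) = v" for v
    by (simp_all add: matrix_vector_mul_assoc inv)
  have m: "(\<lambda>y. \<sigma> *\<^sub>R (Q *v y) + \<mu>) \<in> measurable F borel"
    unfolding measurable_cong_sets[OF assms(1) refl]
    by (intro borel_measurable_continuous_onI continuous_intros matrix_vector_mult_linear_continuous_on)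
  have "(\<lambda>t. (matrix_inv Q *v (t - \<mu>)) /\<^sub>R \<sigma>) ` S = (\<lambda>y. \<sigma> *\<^sub>R (Q *v y) + \<mu>) -` S \<inter> space F"
    (is "?L = ?R")
  proof
    show "?L \<subseteq> ?R" using assms(2) sets_eq_imp_space_eq[OF assms(1)] by (auto simp: matrix_vector_mult_scaleR)
    show "?R \<subseteq> ?L"
    proof
      fix y assume "y \<in> ?R"
      then show "y \<in> ?L" using assms(2)
        by (intro image_eqI[of _ _ "\<sigma> *\<^sub>R (Q *v y) + \<mu>"]) (auto simp: matrix_vector_mult_scaleR)
    qed
  qed
  then show ?thesis unfolding similarity_law_def by (simp add: measure_distr[OF m assms(4)])
qed

lemma cdf_scaled_law:
  assumes "sets G = sets borel" and "\<sigma> > 0"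
  shows "cdf (scaled_law \<sigma> G) t = cdf G (t / \<sigma>)"
proof -
  have m: "(\<lambda>s. \<sigma> * s) \<in> measurable G borel"
    unfolding measurable_cong_sets[OF assms(1) refl] by measurable
  have "(\<lambda>s. \<sigma> * s) -` {..t} \<inter> space G = {..t / \<sigma>}"
    using assms(2) sets_eq_imp_space_eq[OF assms(1)] by (auto simp: field_simps)
  then show ?thesis by (simp add: cdf_def scaled_law_def measure_distr[OF m])
qed

end

theory Submission
  imports Defs
begin

text \<open>
  Everything rests on one function. For a unit vector \<open>u\<close> and \<open>T = tan (\<alpha> / 2)\<close>, let
  \<open>tip_height T u w\<close> be the height along \<open>u\<close> at which the tip of a downward cone must be placed for
  its boundary to pass through \<open>w\<close>. For \<open>s \<ge> 0\<close> the cone with tip \<open>x + s u\<close> is the sublevel set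
  \<open>tip_height T u (z - x) \<le> s\<close>, and for \<open>s < 0\<close> it is the cone of \<open>- u\<close> at \<open>- s\<close>. On each side of \<open>0\<close>
  the depth function is therefore the minimum of two distribution functions of \<open>tip_height\<close>, one for
  each half-space. The function \<open>tip_height T u\<close> is convex, so its level sets are null and the depth
  is continuous; each strip between two nonnegative levels meets both open half-spaces, so under a positive
  density the depth is strictly monotone; and the cones exhaust the half-spaces, so the depth tends to
  the half-space depth \<open>m\<close> of \<open>x\<close> in direction \<open>u\<close> without attaining it. In short, the depth is a
  valley with bottom value \<open>0\<close> at \<open>s = 0\<close> (\<open>valley_depth_fun\<close>).

  The rest of (a) and (b) is one-dimensional. For a valley \<open>D\<close> and a positive law \<open>G\<close>, the mass of the
  interval \<open>{s. D s \<le> t}\<close> is continuous and strictly increasing in \<open>t \<in> [0, m]\<close>, from \<open>0\<close> to \<open>1\<close>, and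
  the quantile function is its inverse.

  For (c), \<open>D s\<close> is, for small \<open>\<bar>s\<bar>\<close>, the mass of the cone between tip and base, which at a Lebesgue
  point of \<open>f\<close> is asymptotic to \<open>f x\<close> times its volume, say \<open>c \<bar>s\<bar> ^ d\<close>. Hence both end points of the
  sublevel interval at level \<open>q\<close> are asymptotic to \<open>(q / c) powr (1 / d)\<close> in modulus, and the mass
  \<open>\<delta>\<close> of the interval is asymptotic to \<open>2 g(0) (q / c) powr (1 / d)\<close>; solving for \<open>q\<close> gives the limit
  (\<open>quantile_asymptotics\<close>). The volume is computed for a coordinate direction by Fubini and
  transferred to \<open>u\<close> by the rotation invariance of Lebesgue measure.

  For (d), a similarity maps cones to cones and multiplies the position of the tip by \<open>\<sigma>\<close>
  (\<open>depth_fun_similarity\<close>).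

  For \<open>\<alpha> = 0\<close> the cones are half-lines, which are null sets, so that the depth and the quantile
  function vanish identically on \<open>\<delta> \<le> 1\<close>.
\<close>

section \<open>Cones as sublevel sets\<close>

text \<open>The cone widens by \<open>T\<close> per unit of height. The first summand is the height of \<open>w\<close>; the second, the
  distance of \<open>w\<close> from the axis divided by \<open>T\<close>, is the height of the tip above \<open>w\<close>.\<close>

definition tip_height :: "real \<Rightarrow> 'a::euclidean_space \<Rightarrow> 'a \<Rightarrow> real" where
  "tip_height T u w = inner w u + norm (w - inner w u *\<^sub>R u) / T"

lemma half_angle_pos:
  assumes "0 < \<alpha>" "\<alpha> < pi"
  shows "cos (\<alpha> / 2) > 0" "sin (\<alpha> / 2) > 0" "tan (\<alpha> / 2) > 0"
  using assms by (auto intro!: cos_gt_zero sin_gt_zero tan_gt_zero)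

lemma norm_diff_axis_power2:
  assumes "norm u = 1"
  shows "(norm (w - s *\<^sub>R u))\<^sup>2 = (norm (w - inner w u *\<^sub>R u))\<^sup>2 + (s - inner w u)\<^sup>2"
proof -
  have uu: "inner u u = 1" using assms by (simp add: norm_eq_1)
  show ?thesis
    unfolding power2_norm_eq_inner
    by (simp add: inner_diff_left inner_diff_right uu inner_commute[of u w] power2_eq_square algebra_simps)
qed

text \<open>With \<open>p\<close> the depth of \<open>z\<close> below the tip and \<open>r\<close> its distance from the axis, the defining condition
  is \<open>cos (\<alpha> / 2) * sqrt (r\<^sup>2 + p\<^sup>2) \<le> p\<close>. Squaring and \<open>cos\<^sup>2 + sin\<^sup>2 = 1\<close> turn it into
  \<open>r cos (\<alpha> / 2) \<le> p sin (\<alpha> / 2)\<close>.\<close>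

lemma cone_eq_tip_height:
  assumes \<alpha>: "0 < \<alpha>" "\<alpha> < pi" and u: "norm u = 1" and s: "s \<ge> 0"
  shows "cone \<alpha> x u s = {z. tip_height (tan (\<alpha> / 2)) u (z - x) \<le> s}"
proof -
  define c where "c = cos (\<alpha> / 2)"
  define k where "k = sin (\<alpha> / 2)"
  have ck: "c > 0" "k > 0" "c\<^sup>2 + k\<^sup>2 = 1"
    using half_angle_pos[OF \<alpha>] by (auto simp: c_def k_def)
  have key: "c * norm (w - s *\<^sub>R u) \<le> s - inner w u \<longleftrightarrow> tip_height (tan (\<alpha> / 2)) u w \<le> s" for w
  proof -
    define p where "p = s - inner w u"
    define r where "r = norm (w - inner w u *\<^sub>R u)"
    define n where "n = norm (w - s *\<^sub>R u)"
    have n: "n\<^sup>2 = r\<^sup>2 + p\<^sup>2" "n \<ge> 0" "r \<ge> 0"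
      using norm_diff_axis_power2[OF u, of w s] by (auto simp: n_def r_def p_def)
    have sq: "(c * n)\<^sup>2 \<le> p\<^sup>2 \<longleftrightarrow> (r * c)\<^sup>2 \<le> (p * k)\<^sup>2"
    proof -
      have "p\<^sup>2 - (c * n)\<^sup>2 = p\<^sup>2 * (c\<^sup>2 + k\<^sup>2) - c\<^sup>2 * (r\<^sup>2 + p\<^sup>2)"
        using ck n by (simp add: power_mult_distrib)
      also have "\<dots> = (p * k)\<^sup>2 - (r * c)\<^sup>2" by (simp add: algebra_simps power_mult_distrib)
      finally show ?thesis by linarith
    qed
    have "c * n \<le> p \<longleftrightarrow> r * c \<le> p * k"
    proof
      assume a: "c * n \<le> p"
      then have "0 \<le> p" using ck n by (meson mult_nonneg_nonneg less_imp_le order_trans)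
      with a sq have "(r * c)\<^sup>2 \<le> (p * k)\<^sup>2" using ck n by (simp add: power_mono)
      then show "r * c \<le> p * k" by (rule power2_le_imp_le) (use \<open>0 \<le> p\<close> ck in simp)
    next
      assume a: "r * c \<le> p * k"
      then have "0 \<le> p * k" using ck n by (meson mult_nonneg_nonneg less_imp_le order_trans)
      then have "0 \<le> p" using ck by (simp add: zero_le_mult_iff)
      have "(r * c)\<^sup>2 \<le> (p * k)\<^sup>2" using a ck n by (simp add: power_mono)
      with sq have "(c * n)\<^sup>2 \<le> p\<^sup>2" by simp
      then show "c * n \<le> p" by (rule power2_le_imp_le) (use \<open>0 \<le> p\<close> in simp)
    qed
    also have "r * c \<le> p * k \<longleftrightarrow> r / tan (\<alpha> / 2) \<le> p"
      using ck by (simp add: tan_def c_def[symmetric] k_def[symmetric] field_simps)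
    finally show ?thesis unfolding p_def r_def n_def tip_height_def by linarith
  qed
  have "inner (z - (x + s *\<^sub>R u)) (- u) = s - inner (z - x) u" for z
    using u by (simp add: inner_diff_left inner_add_left algebra_simps flip: norm_eq_1)
  then have "cos (\<alpha> / 2) * norm (z - (x + s *\<^sub>R u)) \<le> inner (z - (x + s *\<^sub>R u)) (- u) \<longleftrightarrow>
      tip_height (tan (\<alpha> / 2)) u (z - x) \<le> s" for z
    using key[of "z - x"] by (simp add: c_def diff_diff_eq del: inner_minus_right)
  then show ?thesis using s unfolding cone_def Let_def by (simp del: inner_minus_right)
qed

lemma tip_height_combination_le:
  assumes "T > 0" "a \<ge> 0" "b \<ge> 0"
  shows "tip_height T u (a *\<^sub>R v + b *\<^sub>R w) \<le> a * tip_height T u v + b * tip_height T u w"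
proof -
  have "norm ((a *\<^sub>R v + b *\<^sub>R w) - inner (a *\<^sub>R v + b *\<^sub>R w) u *\<^sub>R u) =
    norm (a *\<^sub>R (v - inner v u *\<^sub>R u) + b *\<^sub>R (w - inner w u *\<^sub>R u))"
    by (simp add: inner_add_left algebra_simps)
  also have "\<dots> \<le> a * norm (v - inner v u *\<^sub>R u) + b * norm (w - inner w u *\<^sub>R u)"
    using assms by (intro norm_triangle_le) simp
  finally have "norm ((a *\<^sub>R v + b *\<^sub>R w) - inner (a *\<^sub>R v + b *\<^sub>R w) u *\<^sub>R u) / T \<le>
     (a * norm (v - inner v u *\<^sub>R u) + b * norm (w - inner w u *\<^sub>R u)) / T"
    using assms by (simp add: divide_right_mono)
  then show ?thesis by (simp add: tip_height_def inner_add_left add_divide_distrib algebra_simps)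
qed

lemma tip_height_add_axis:
  assumes "norm u = 1"
  shows "tip_height T u (w + t *\<^sub>R u) = tip_height T u w + t"
  using assms by (simp add: tip_height_def inner_add_left dot_square_norm algebra_simps)

lemma continuous_on_tip_height [continuous_intros]:
  "continuous_on S h \<Longrightarrow> continuous_on S (\<lambda>z. tip_height T u (h z))"
  unfolding tip_height_def divide_inverse by (intro continuous_intros)

text \<open>Sublevel sets are convex, and moving up the axis strictly increases \<open>tip_height\<close>; so a level set
  lies in the frontier of a convex set.\<close>

lemma negligible_tip_height_level:
  assumes "T > 0" "norm u = 1"
  shows "negligible {z. tip_height T u (z - x) = c}"
proof -
  let ?S = "{z. tip_height T u (z - x) \<le> c}"
  have "convex ?S"
  proof (rule convexI)
    fix y z and a b :: real
    assume A: "y \<in> ?S" "z \<in> ?S" "0 \<le> a" "0 \<le> b" "a + b = 1"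
    have "(a *\<^sub>R y + b *\<^sub>R z) - x = (a *\<^sub>R y + b *\<^sub>R z) - (a + b) *\<^sub>R x" using A by simp
    also have "\<dots> = a *\<^sub>R (y - x) + b *\<^sub>R (z - x)" by (simp add: algebra_simps)
    finally have "tip_height T u ((a *\<^sub>R y + b *\<^sub>R z) - x) \<le>
        a * tip_height T u (y - x) + b * tip_height T u (z - x)"
      using tip_height_combination_le[OF assms(1) A(3,4)] by simp
    also have "\<dots> \<le> a * c + b * c" using A by (intro add_mono mult_left_mono) auto
    also have "\<dots> = c" using A by (simp flip: distrib_right)
    finally show "a *\<^sub>R y + b *\<^sub>R z \<in> ?S" by simp
  qed
  moreover have "{z. tip_height T u (z - x) = c} \<subseteq> frontier ?S"
  proof
    fix z assume "z \<in> {z. tip_height T u (z - x) = c}"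
    then have z: "tip_height T u (z - x) = c" by simp
    have "z \<notin> interior ?S"
    proof
      assume "z \<in> interior ?S"
      then obtain e where e: "e > 0" "ball z e \<subseteq> ?S" by (auto simp: mem_interior)
      then have "z + (e / 2) *\<^sub>R u \<in> ball z e" using assms by (simp add: dist_norm)
      with e have "tip_height T u ((z - x) + (e / 2) *\<^sub>R u) \<le> c" by (auto simp: algebra_simps)
      then show False using z e by (simp add: tip_height_add_axis[OF assms(2)])
    qed
    then show "z \<in> frontier ?S" using z closure_subset[of ?S] by (auto simp: frontier_def)
  qed
  ultimately show ?thesis using negligible_convex_frontier negligible_subset by blast
qed

lemma cone_uminus:
  assumes "s < 0"
  shows "cone \<alpha> x u s = cone \<alpha> x (- u) (- s)"
    "cone_A \<alpha> x u s = cone_A \<alpha> x (- u) (- s)"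
    "cone_B \<alpha> x u s = cone_B \<alpha> x (- u) (- s)"
  using assms by (auto simp: cone_def cone_A_def cone_B_def)

lemma closed_cone: "closed (cone \<alpha> x u s)"
  unfolding cone_def Let_def
  by (auto intro!: closed_Collect_le continuous_intros)

lemma closed_cone_A: "closed (cone_A \<alpha> x u s)" and closed_cone_B: "closed (cone_B \<alpha> x u s)"
  unfolding cone_A_def cone_B_def
  by (auto intro!: closed_Int closed_cone closed_Collect_le continuous_intros)

text \<open>Equality in the Cauchy--Schwarz inequality puts the degenerate cone on the axis, hence in a
  hyperplane.\<close>

lemma negligible_cone_degenerate:
  assumes u: "norm u = 1" and dim: "DIM('a) \<ge> 2"
  shows "negligible (cone 0 x (u::'a::euclidean_space) s)"
proof -
  obtain e where e: "e \<noteq> 0" "orthogonal u e"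
    using orthogonal_to_vector_exists[OF dim, of u] by blast
  have "cone 0 x u s \<subseteq> {z. inner e z = inner e x}"
  proof
    fix z assume z: "z \<in> cone 0 x u s"
    define v where "v = z - (x + s *\<^sub>R u)"
    have "norm v \<le> \<bar>inner v u\<bar>" using z by (auto simp: cone_def Let_def v_def split: if_splits)
    then have "\<bar>inner v u\<bar> = norm v * norm u" using Cauchy_Schwarz_ineq2[of v u] u by auto
    then have "norm v *\<^sub>R u = u' \<or> norm v *\<^sub>R u = - u'" if "u' = norm u *\<^sub>R v" for u'
      using that by (auto simp: norm_cauchy_schwarz_abs_eq)
    then have "v = norm v *\<^sub>R u \<or> v = - (norm v *\<^sub>R u)" using u by auto
    then have "inner e v = 0" using e by (metis inner_commute inner_minus_right inner_scaleR_right mult_zero_right neg_0_equal_iff_equal orthogonal_def)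
    then show "z \<in> {z. inner e z = inner e x}"
      using e by (simp add: v_def inner_diff_right inner_add_right orthogonal_def inner_commute)
  qed
  then show ?thesis using negligible_hyperplane[of e "inner e x"] e negligible_subset by blast
qed

section \<open>Volume of a cone\<close>

text \<open>Uniqueness of Haar measure, in the case where one measure is Lebesgue measure: integrate
  \<open>1\<^sub>S(x) 1\<^sub>B(x + y)\<close> against \<open>M \<Otimes> lborel\<close> in both orders, using the invariance of each factor, to
  obtain \<open>M S * lborel B = lborel S * M B\<close>. The unit ball \<open>B\<close> fixes the normalisation, and it is a
  good choice because isometries preserve it.\<close>

lemma translation_invariant_eq_lborel:
  fixes M :: "'a::euclidean_space measure"
  assumes sets: "sets M = sets borel" and fin: "sigma_finite_measure M"
    and trans: "\<And>a. distr M borel (\<lambda>z. a + z) = M"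
    and ball: "emeasure M (ball 0 1) = emeasure lborel (ball (0::'a) 1)"
  shows "M = lborel"
proof (rule measure_eqI)
  show "sets M = sets lborel" using sets by simp
  interpret M: sigma_finite_measure M by (rule fin)
  interpret P: pair_sigma_finite M lborel by unfold_locales
  note [measurable_cong] = sets
  fix S assume "S \<in> sets M"
  then have S[measurable]: "S \<in> sets borel" using sets by simp
  let ?B = "ball (0::'a) 1"
  have [measurable]: "?B \<in> sets borel" by simp
  let ?i = "\<lambda>x y. indicator S x * (indicator ?B y :: ennreal)"
  have ishift: "(\<integral>\<^sup>+x. h (a + x) \<partial>M) = (\<integral>\<^sup>+x. h x \<partial>M)" if [measurable]: "h \<in> borel_measurable borel" for a h
  proof -
    have "(\<integral>\<^sup>+x. h x \<partial>M) = (\<integral>\<^sup>+x. h x \<partial>distr M borel (\<lambda>z. a + z))" by (simp only: trans)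
    also have "\<dots> = (\<integral>\<^sup>+x. h (a + x) \<partial>M)" by (subst nn_integral_distr) auto
    finally show ?thesis ..
  qed
  have lshift: "(\<integral>\<^sup>+y. h (a + y) \<partial>lborel) = (\<integral>\<^sup>+y. h y \<partial>lborel)"
    and lflip: "(\<integral>\<^sup>+y. h (a - y) \<partial>lborel) = (\<integral>\<^sup>+y. h y \<partial>lborel)"
    if [measurable]: "h \<in> borel_measurable borel" for a and h :: "'a \<Rightarrow> ennreal"
  proof -
    have "(\<integral>\<^sup>+y. h y \<partial>lborel) = (\<integral>\<^sup>+y. h y \<partial>distr lborel borel (\<lambda>y. a + 1 *\<^sub>R y))"
      by (subst lborel_affine[of 1 a]) (simp_all add: density_1)
    then show "(\<integral>\<^sup>+y. h (a + y) \<partial>lborel) = (\<integral>\<^sup>+y. h y \<partial>lborel)" by (simp add: nn_integral_distr)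
    have "(\<integral>\<^sup>+y. h y \<partial>lborel) = (\<integral>\<^sup>+y. h y \<partial>distr lborel borel (\<lambda>y. a + (-1) *\<^sub>R y))"
      by (subst lborel_affine[of "-1" a]) (simp_all add: density_1)
    then show "(\<integral>\<^sup>+y. h (a - y) \<partial>lborel) = (\<integral>\<^sup>+y. h y \<partial>lborel)" by (simp add: nn_integral_distr)
  qed
  have "emeasure M S * emeasure lborel ?B = (\<integral>\<^sup>+x. \<integral>\<^sup>+y. ?i x y \<partial>lborel \<partial>M)"
    by (simp add: nn_integral_cmult_indicator nn_integral_multc)
  also have "\<dots> = (\<integral>\<^sup>+x. \<integral>\<^sup>+y. ?i x (x + y) \<partial>lborel \<partial>M)"
    by (rule nn_integral_cong, rule lshift[symmetric]) measurable
  also have "\<dots> = (\<integral>\<^sup>+y. \<integral>\<^sup>+x. ?i x (x + y) \<partial>M \<partial>lborel)"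
    by (rule P.Fubini'[symmetric]) measurable
  also have "\<dots> = (\<integral>\<^sup>+y. \<integral>\<^sup>+x. ?i (x - y) x \<partial>M \<partial>lborel)"
  proof (rule nn_integral_cong)
    fix y :: 'a
    have "(\<integral>\<^sup>+x. ?i (x - y) x \<partial>M) = (\<integral>\<^sup>+x. ?i (y + x - y) (y + x) \<partial>M)"
      by (rule ishift[symmetric]) measurable
    then show "(\<integral>\<^sup>+x. ?i x (x + y) \<partial>M) = (\<integral>\<^sup>+x. ?i (x - y) x \<partial>M)" by (simp add: add.commute)
  qed
  also have "\<dots> = (\<integral>\<^sup>+x. \<integral>\<^sup>+y. ?i (x - y) x \<partial>lborel \<partial>M)"
    by (rule P.Fubini') measurable
  also have "\<dots> = (\<integral>\<^sup>+x. \<integral>\<^sup>+y. ?i y x \<partial>lborel \<partial>M)"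
    by (rule nn_integral_cong, rule lflip) measurable
  also have "\<dots> = emeasure lborel S * emeasure M ?B"
    by (simp add: nn_integral_cmult_indicator nn_integral_multc)
  finally have eq: "emeasure M S * emeasure lborel ?B = emeasure lborel S * emeasure lborel ?B"
    using ball by simp
  have "emeasure lborel ?B \<noteq> \<infinity>" "emeasure lborel ?B \<noteq> 0"
    using emeasure_bounded_finite[of ?B] open_not_negligible[of ?B]
    by (auto simp: negligible_iff_emeasure0 emeasure_lborel_countable)
  then show "emeasure M S = emeasure lborel S"
    using eq by (metis mult.commute ennreal_mult_cancel_left infinity_ennreal_def)
qed

lemma distr_lborel_orthogonal:
  fixes h :: "'a::euclidean_space \<Rightarrow> 'a"
  assumes h: "orthogonal_transformation h"
  shows "distr lborel borel h = lborel"
proof (rule translation_invariant_eq_lborel)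
  have lin: "linear h" and nrm: "\<And>v. norm (h v) = norm v"
    using h by (auto simp: orthogonal_transformation)
  have [measurable]: "h \<in> borel_measurable borel"
    using lin by (intro borel_measurable_continuous_onI linear_continuous_on) (simp add: linear_conv_bounded_linear)
  have vim: "h -` ball 0 r = ball 0 r" for r using nrm by auto
  show "sets (distr lborel borel h) = sets borel" by simp
  show "emeasure (distr lborel borel h) (ball 0 1) = emeasure lborel (ball (0::'a) 1)"
    by (subst emeasure_distr) (auto simp: vim)
  show "sigma_finite_measure (distr lborel borel h)"
  proof
    show "\<exists>A. countable A \<and> A \<subseteq> sets (distr lborel borel h) \<and> \<Union> A = space (distr lborel borel h) \<and>
        (\<forall>a\<in>A. emeasure (distr lborel borel h) a \<noteq> \<infinity>)"
    proof (intro exI[of _ "range (\<lambda>n::nat. ball 0 (real n))"] conjI ballI)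
      show "\<Union> (range (\<lambda>n::nat. ball 0 (real n))) = space (distr lborel borel h)"
        by (auto intro: reals_Archimedean2)
      fix a assume "a \<in> range (\<lambda>n::nat. ball (0::'a) (real n))"
      then show "emeasure (distr lborel borel h) a \<noteq> \<infinity>"
        using emeasure_bounded_finite[OF bounded_ball[of "0::'a"]]
        by (auto simp: emeasure_distr vim less_top[symmetric])
    qed auto
  qed
  fix a
  obtain b where b: "h b = a"
    using orthogonal_transformation_surj[OF h] by (metis surjD)
  have "distr (distr lborel borel h) borel (\<lambda>z. a + z) = distr lborel borel ((\<lambda>z. a + z) \<circ> h)"
    by (rule distr_distr) auto
  also have "(\<lambda>z. a + z) \<circ> h = h \<circ> (\<lambda>z. b + z)"
    using linear_add[OF lin] b by auto
  also have "distr lborel borel (h \<circ> (\<lambda>z. b + z)) = distr (distr lborel borel (\<lambda>z. b + z)) borel h"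
    by (rule distr_distr[symmetric]) auto
  also have "distr lborel borel (\<lambda>z. b + z) = (lborel :: 'a measure)"
    using lborel_affine[of 1 b] by (simp add: density_1)
  finally show "distr (distr lborel borel h) borel (\<lambda>z. a + z) = distr lborel borel h" .
qed

lemma tip_height_orthogonal:
  assumes "orthogonal_transformation h"
  shows "tip_height T (h b) (h w) = tip_height T b w" "inner (h w) (h b) = inner w b"
proof -
  have lin: "linear h" and inn: "\<And>v w. inner (h v) (h w) = inner v w"
    using assms by (auto simp: orthogonal_transformation_def)
  then have nrm: "\<And>v. norm (h v) = norm v" by (simp add: norm_eq_sqrt_inner)
  show "inner (h w) (h b) = inner w b" by (rule inn)
  have "h w - inner w b *\<^sub>R h b = h (w - inner w b *\<^sub>R b)"
    by (simp add: linear_diff[OF lin] linear_scale[OF lin])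
  then show "tip_height T (h b) (h w) = tip_height T b w"
    by (simp add: tip_height_def inn nrm)
qed

text \<open>For a coordinate direction \<open>b\<close>, slicing at height \<open>y\<close> gives a ball of radius \<open>T * (s - y)\<close> in the
  remaining coordinates, whose volumes integrate to the one claimed.\<close>

lemma emeasure_cone_tip_Basis:
  fixes b :: "'a::euclidean_space"
  assumes b: "b \<in> Basis" and T: "T > 0" and s: "s \<ge> 0"
  shows "emeasure lborel {w. inner w b \<ge> 0 \<and> tip_height T b w \<le> s} =
    ennreal (unit_ball_vol (real (DIM('a) - 1)) * T ^ (DIM('a) - 1) / real DIM('a) * s ^ DIM('a))"
proof -
  interpret product_sigma_finite "\<lambda>_::'a. lborel :: real measure" by standard
  define A where "A = Basis - {b}"
  define n where "n = DIM('a) - 1"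
  have A: "finite A" "b \<notin> A" "insert b A = Basis" "card A = n"
    using b by (auto simp: A_def n_def)
  have dim: "DIM('a) = Suc n" using DIM_positive[where 'a='a] by (simp add: n_def)
  let ?S = "{w. inner w b \<ge> 0 \<and> tip_height T b w \<le> s}"
  let ?P = "Pi\<^sub>M Basis (\<lambda>_::'a. lborel :: real measure)"
  let ?Q = "Pi\<^sub>M A (\<lambda>_::'a. lborel :: real measure)"
  let ?m = "\<lambda>f::'a \<Rightarrow> real. \<Sum>i\<in>Basis. f i *\<^sub>R i"
  have closedS: "closed ?S"
    by (auto intro!: closed_Collect_conj closed_Collect_le continuous_intros)
  then have S[measurable]: "?S \<in> sets borel" by simp
  have th: "inner (?m f) b = f b" "tip_height T b (?m f) = f b + sqrt (\<Sum>i\<in>A. (f i)\<^sup>2) / T" for f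
  proof -
    show 1: "inner (?m f) b = f b" using b by simp
    have "?m f = f b *\<^sub>R b + (\<Sum>i\<in>A. f i *\<^sub>R i)"
      using sum.insert[OF A(1,2), of "\<lambda>i. f i *\<^sub>R i"] by (simp only: A(3))
    then have "?m f - f b *\<^sub>R b = (\<Sum>i\<in>A. f i *\<^sub>R i)" by simp
    moreover have "norm (\<Sum>i\<in>A. f i *\<^sub>R i) = sqrt (\<Sum>i\<in>A. (f i)\<^sup>2)"
    proof -
      have "(norm (\<Sum>i\<in>A. f i *\<^sub>R i))\<^sup>2 = (\<Sum>i\<in>A. (norm (f i *\<^sub>R i))\<^sup>2)"
        by (rule norm_sum_Pythagorean)
           (use A in \<open>auto simp: pairwise_def orthogonal_def A_def inner_Basis\<close>)
      also have "\<dots> = (\<Sum>i\<in>A. (f i)\<^sup>2)"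
        by (rule sum.cong) (auto simp: A_def)
      finally show ?thesis by (metis norm_ge_zero real_sqrt_unique)
    qed
    ultimately show "tip_height T b (?m f) = f b + sqrt (\<Sum>i\<in>A. (f i)\<^sup>2) / T"
      by (simp add: tip_height_def 1)
  qed
  define c where "c = unit_ball_vol (real n)"
  define U where "U = {f. f b \<ge> 0 \<and> f b + sqrt (\<Sum>i\<in>A. (f i)\<^sup>2) / T \<le> s}"
  have mm[measurable]: "?m \<in> measurable ?P borel" by measurable
  have iU: "indicator ?S (?m f) = (indicator U f :: ennreal)" for f
    by (simp only: indicator_def mem_Collect_eq th U_def)
  have "(\<lambda>f. indicator ?S (?m f) :: ennreal) \<in> borel_measurable ?P" by measurable
  then have mU: "(indicator U :: _ \<Rightarrow> ennreal) \<in> borel_measurable ?P" by (simp only: iU)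
  have "emeasure lborel ?S = emeasure (distr ?P borel ?m) ?S"
    by (subst lborel_eq) simp
  also have "\<dots> = (\<integral>\<^sup>+f. indicator ?S f \<partial>distr ?P borel ?m)" by simp
  also have "\<dots> = (\<integral>\<^sup>+f. indicator ?S (?m f) \<partial>?P)" by (rule nn_integral_distr) auto
  also have "\<dots> = (\<integral>\<^sup>+f. indicator U f \<partial>?P)"
    by (simp only: iU)
  also have "\<dots> = (\<integral>\<^sup>+f. indicator U f
      \<partial>Pi\<^sub>M (insert b A) (\<lambda>_. lborel))" by (simp add: A)
  also have "\<dots> = (\<integral>\<^sup>+y. \<integral>\<^sup>+f. indicator U (f(b := y))
      \<partial>?Q \<partial>lborel)"
    by (rule product_nn_integral_insert_rev) (use A mU in simp_all)
  also have "\<dots> = (\<integral>\<^sup>+y. ennreal (c * (T * (s - y)) ^ n) * indicator {0..s} y \<partial>lborel)"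
  \<comment> \<open>The slice at the tip, a ball of radius \<open>0\<close>, is left out: the volume formula used for the slices needs a positive radius.\<close>
  proof (rule nn_integral_cong_AE, rule AE_I[where N="{s}"])
    show "{y \<in> space lborel. \<not> (\<integral>\<^sup>+f. indicator U (f(b := y))
      \<partial>?Q) = ennreal (c * (T * (s - y)) ^ n) * indicator {0..s} y} \<subseteq> {s}"
    proof (clarify, rule ccontr)
      fix y assume ne: "(\<integral>\<^sup>+f. indicator U (f(b := y))
        \<partial>?Q) \<noteq> ennreal (c * (T * (s - y)) ^ n) * indicator {0..s} y" and "y \<noteq> s"
      have upd: "(\<Sum>i\<in>A. ((f(b := y)) i)\<^sup>2) = (\<Sum>i\<in>A. (f i)\<^sup>2)" for f :: "'a \<Rightarrow> real"
        using A by (intro sum.cong) auto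
      have "(\<integral>\<^sup>+f. indicator U (f(b := y)) \<partial>?Q) =
        (\<integral>\<^sup>+f. indicator {0..s} y * indicator ({f. sqrt (\<Sum>i\<in>A. (f i)\<^sup>2) \<le> T * (s - y)} \<inter> space ?Q) f \<partial>?Q)"
      proof (rule nn_integral_cong)
        fix f assume f: "f \<in> space ?Q"
        have ge: "0 \<le> sqrt (\<Sum>i\<in>A. (f i)\<^sup>2) / T" using T by (simp add: sum_nonneg)
        have "y + sqrt (\<Sum>i\<in>A. (f i)\<^sup>2) / T \<le> s \<longleftrightarrow> sqrt (\<Sum>i\<in>A. (f i)\<^sup>2) \<le> T * (s - y)"
          using T by (simp add: field_simps)
        then show "indicator U (f(b := y)) =
            (indicator {0..s} y * indicator ({f. sqrt (\<Sum>i\<in>A. (f i)\<^sup>2) \<le> T * (s - y)} \<inter> space ?Q) f :: ennreal)"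
          using f ge by (auto simp: U_def indicator_def upd simp del: fun_upd_apply split: if_splits)
             (auto simp: upd)
      qed
      also have "\<dots> = indicator {0..s} y * emeasure ?Q ({f. sqrt (\<Sum>i\<in>A. (f i)\<^sup>2) \<le> T * (s - y)} \<inter> space ?Q)"
        by (subst nn_integral_cmult) auto
      also have "\<dots> = ennreal (c * (T * (s - y)) ^ n) * indicator {0..s} y"
      proof (cases "0 \<le> y \<and> y < s")
        case True
        then show ?thesis using T A
          by (subst emeasure_cball_aux) (auto simp: c_def mult.commute)
      next
        case False
        then show ?thesis using \<open>y \<noteq> s\<close> by (auto simp: indicator_def)
      qed
      finally show False using ne by simp
    qed
  qed auto
  also have "\<dots> = ennreal ((- c * T ^ n * (s - s) ^ Suc n / Suc n) - (- c * T ^ n * (s - 0) ^ Suc n / Suc n))"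
  proof (rule nn_integral_FTC_Icc[where F = "\<lambda>y. - c * T ^ n * (s - y) ^ Suc n / Suc n"])
    show "(\<lambda>y. c * (T * (s - y)) ^ n) \<in> borel_measurable borel" by measurable
    show "0 \<le> c * (T * (s - y)) ^ n" if "y \<in> {0..s}" for y
      using that T by (simp add: c_def)
    show "((\<lambda>y. - c * T ^ n * (s - y) ^ Suc n / Suc n) has_real_derivative c * (T * (s - y)) ^ n) (at y)" for y
      by (rule derivative_eq_intros refl | simp add: power_mult_distrib del: of_nat_Suc power_Suc)+
  qed (use s in auto)
  also have "\<dots> = ennreal (c * T ^ n / real (Suc n) * s ^ Suc n)" by simp
  finally show ?thesis unfolding dim c_def n_def[symmetric] by simp
qed

text \<open>A rotation carries the coordinate direction to \<open>u\<close>.\<close>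

lemma measure_cone_tip:
  fixes u :: "real ^ 'n"
  assumes u: "norm u = 1" and T: "T > 0" and s: "s \<ge> 0"
  shows "measure lborel {z. inner (z - x) u \<ge> 0 \<and> tip_height T u (z - x) \<le> s} =
    unit_ball_vol (real (CARD('n) - 1)) * T ^ (CARD('n) - 1) / real CARD('n) * s ^ CARD('n)"
proof -
  define b where "b = (axis undefined 1 :: real ^ 'n)"
  have b: "b \<in> Basis" by (simp add: b_def axis_in_Basis_iff)
  then obtain h where h: "orthogonal_transformation h" "h b = u"
    using orthogonal_transformation_exists_1[of b u] u by auto
  let ?S = "\<lambda>u. {w::real^'n. inner w u \<ge> 0 \<and> tip_height T u w \<le> s}"
  have S: "?S u \<in> sets borel"
    by (rule borel_closed) (auto intro!: closed_Collect_conj closed_Collect_le continuous_intros)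
  have [measurable]: "h \<in> borel_measurable borel"
    using orthogonal_transformation_linear[OF h(1)]
    by (intro borel_measurable_continuous_onI linear_continuous_on) (simp add: linear_conv_bounded_linear)
  have "emeasure lborel {z. inner (z - x) u \<ge> 0 \<and> tip_height T u (z - x) \<le> s} =
     emeasure (distr lborel borel (\<lambda>z. - x + z)) (?S u)"
    using S by (subst emeasure_distr) (auto simp: vimage_def)
  also have "distr lborel borel (\<lambda>z. - x + z) = lborel"
    using lborel_affine[of 1 "-x"] by (simp add: density_1)
  also have "emeasure lborel (?S u) = emeasure (distr lborel borel h) (?S u)"
    by (simp only: distr_lborel_orthogonal[OF h(1)])
  also have "\<dots> = emeasure lborel (?S b)"
    using S tip_height_orthogonal(1)[OF h(1), where T = T and b = b]
      tip_height_orthogonal(2)[OF h(1), where b = b] unfolding h(2)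
    by (subst emeasure_distr) (auto simp: vimage_def)
  also have "\<dots> = ennreal (unit_ball_vol (real (CARD('n) - 1)) * T ^ (CARD('n) - 1) / real CARD('n) * s ^ CARD('n))"
    using emeasure_cone_tip_Basis[OF b T s] by simp
  finally show ?thesis using T s by (simp add: measure_def)
qed

section \<open>Depth along a half-line\<close>

text \<open>The depth function on \<open>s \<ge> 0\<close>, by \<open>depth_fun_eq_half_depth\<close>. For an absolutely
  continuous law the same formula vanishes for \<open>s \<le> 0\<close>, so that the depth function is a sum of two such functions
  and no gluing at \<open>0\<close> is needed.\<close>

definition half_depth ::
    "real \<Rightarrow> 'a::euclidean_space measure \<Rightarrow> 'a \<Rightarrow> 'a \<Rightarrow> real \<Rightarrow> real" where
  "half_depth T F x u s =
     min (measure F {z. inner (z - x) u \<ge> 0 \<and> tip_height T u (z - x) \<le> s})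
         (measure F {z. inner (z - x) u \<le> 0 \<and> tip_height T u (z - x) \<le> s})"

definition halfspace_depth :: "'a::euclidean_space measure \<Rightarrow> 'a \<Rightarrow> 'a \<Rightarrow> real" where
  "halfspace_depth F x u =
     min (measure F {z. inner (z - x) u \<ge> 0}) (measure F {z. inner (z - x) u \<le> 0})"

lemma halfspace_depth_uminus: "halfspace_depth F x (- u) = halfspace_depth F x u"
  by (simp add: halfspace_depth_def min.commute)

lemma depth_fun_eq_half_depth:
  assumes "0 < \<alpha>" "\<alpha> < pi" "norm u = 1" "s \<ge> 0"
  shows "depth_fun \<alpha> F x u s = half_depth (tan (\<alpha> / 2)) F x u s"
proof -
  have "cone_A \<alpha> x u s = {z. inner (z - x) u \<ge> 0 \<and> tip_height (tan (\<alpha> / 2)) u (z - x) \<le> s}"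
    "cone_B \<alpha> x u s = {z. inner (z - x) u \<le> 0 \<and> tip_height (tan (\<alpha> / 2)) u (z - x) \<le> s}"
    using assms(4) unfolding cone_A_def cone_B_def cone_eq_tip_height[OF assms] by auto
  then show ?thesis by (simp add: depth_fun_def half_depth_def)
qed

lemma depth_fun_uminus: "s < 0 \<Longrightarrow> depth_fun \<alpha> F x u s = depth_fun \<alpha> F x (- u) (- s)"
  by (simp add: depth_fun_def cone_uminus)

lemma sets_tip_sublevel:
  "{z. inner (z - x) u \<ge> 0 \<and> tip_height T u (z - x) \<le> s} \<in> sets borel"
  "{z. inner (z - x) u \<le> 0 \<and> tip_height T u (z - x) \<le> s} \<in> sets borel"
  "{z. inner (z - x) u \<ge> 0} \<in> sets borel" "{z. inner (z - x) u \<le> 0} \<in> sets borel"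
  by (auto intro!: borel_closed closed_Collect_conj closed_Collect_le continuous_intros)

text \<open>The function is the cdf of the law of \<open>\<tau>\<close> under the restriction of \<open>M\<close> to \<open>S\<close>. Since level sets
  are null, that law has no atoms.\<close>

lemma continuous_on_measure_sublevel:
  fixes \<tau> :: "'a \<Rightarrow> real"
  assumes "finite_measure M" and \<tau>: "\<tau> \<in> borel_measurable M" and S: "S \<in> sets M"
    and level: "\<And>c. measure M {z \<in> space M. \<tau> z = c} = 0"
  shows "continuous_on UNIV (\<lambda>s. measure M {z \<in> S. \<tau> z \<le> s})"
proof -
  interpret finite_measure M by fact
  define N where "N = distr (restrict_space M S) borel \<tau>"
  have SM: "S \<inter> space M = S" using sets.sets_into_space[OF S] by auto
  have \<tau>'[measurable]: "\<tau> \<in> borel_measurable (restrict_space M S)"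
    using \<tau> by (rule measurable_restrict_space1)
  have N: "measure N X = measure M {z \<in> S. \<tau> z \<in> X}" if "X \<in> sets borel" for X
  proof -
    have "measure N X = measure (restrict_space M S) (\<tau> -` X \<inter> S)"
      using that unfolding N_def by (subst measure_distr) (auto simp: space_restrict_space SM)
    also have "\<dots> = measure M (\<tau> -` X \<inter> S)"
      using S SM by (intro measure_restrict_space) auto
    also have "\<tau> -` X \<inter> S = {z \<in> S. \<tau> z \<in> X}" by auto
    finally show ?thesis .
  qed
  interpret R: finite_measure "restrict_space M S"
    using finite_measure_axioms S by (rule finite_measure_restrict_space)
  interpret N: finite_borel_measure N
    using R.finite_measure_distr[OF \<tau>']
    by (simp add: finite_borel_measure_def finite_borel_measure_axioms_def N_def)
  have "isCont (cdf N) s" for s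
  proof -
    have "measure N {s} = measure M {z \<in> S. \<tau> z = s}" by (simp add: N)
    also have "\<dots> \<le> measure M {z \<in> space M. \<tau> z = s}"
      using \<tau> sets.sets_into_space[OF S] by (intro finite_measure_mono) auto
    finally show ?thesis using level[of s] by (simp add: N.isCont_cdf measure_le_0_iff)
  qed
  moreover have "cdf N = (\<lambda>s. measure M {z \<in> S. \<tau> z \<le> s})"
    by (simp add: cdf_def N fun_eq_iff)
  ultimately show ?thesis by (simp add: continuous_at_imp_continuous_on)
qed

text \<open>Except in the small-scale limit, densities enter only through two properties: negligible sets
  have mass \<open>0\<close>, and, for positive densities, nonempty open sets have positive mass.\<close>

locale abs_cont_law = prob_space F for F :: "'a::euclidean_space measure" +
  assumes sets_F: "sets F = sets borel"
    and null: "\<And>S. S \<in> sets borel \<Longrightarrow> negligible S \<Longrightarrow> measure F S = 0"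
begin

lemma space_F: "space F = UNIV"
  using sets_eq_imp_space_eq[OF sets_F] by simp

lemma in_sets: "S \<in> sets borel \<Longrightarrow> S \<in> sets F"
  by (simp add: sets_F)

lemma continuous_half_depth:
  assumes "T > 0" "norm u = 1"
  shows "continuous_on UNIV (half_depth T F x u)"
proof -
  have \<tau>: "(\<lambda>z. tip_height T u (z - x)) \<in> borel_measurable F"
    unfolding measurable_cong_sets[OF sets_F refl]
    by (intro borel_measurable_continuous_onI continuous_intros)
  have *: "continuous_on UNIV (\<lambda>s. measure F {z \<in> S. tip_height T u (z - x) \<le> s})" if "S \<in> sets borel" for S
  proof (rule continuous_on_measure_sublevel[OF finite_measure_axioms \<tau>])
    fix c
    have "closed {z. tip_height T u (z - x) = c}"
      by (intro closed_Collect_eq continuous_intros)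
    then show "measure F {z \<in> space F. tip_height T u (z - x) = c} = 0"
      using null[OF _ negligible_tip_height_level[OF assms, of x c]] by (simp add: space_F)
  qed (use that in_sets in auto)
  have "half_depth T F x u = (\<lambda>s. min (measure F {z \<in> {z. inner (z - x) u \<ge> 0}. tip_height T u (z - x) \<le> s})
      (measure F {z \<in> {z. inner (z - x) u \<le> 0}. tip_height T u (z - x) \<le> s}))"
    by (auto simp: half_depth_def fun_eq_iff)
  then show ?thesis
    by (simp only:) (intro continuous_on_min * sets_tip_sublevel)
qed

lemma measure_halfspaces:
  assumes "u \<noteq> 0"
  shows "measure F {z. inner (z - x) u \<ge> 0} = 1 - measure F {z. inner (z - x) u \<le> 0}"
proof -
  have "{z. inner (z - x) u = 0} = {z. inner u z = inner u x}"
    by (auto simp: inner_diff_left inner_commute[of u])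
  then have "negligible {z. inner (z - x) u = 0}"
    using negligible_hyperplane[of u "inner u x"] assms by simp
  moreover have H: "{z. inner (z - x) u = 0} \<in> sets borel" "{z. inner (z - x) u > 0} \<in> sets borel"
    by (auto intro!: borel_closed borel_open closed_Collect_eq open_Collect_less continuous_intros)
  ultimately have z: "measure F {z. inner (z - x) u = 0} = 0" using null by blast
  have "measure F ({z. inner (z - x) u > 0} \<union> {z. inner (z - x) u = 0}) =
      measure F {z. inner (z - x) u > 0} + measure F {z. inner (z - x) u = 0}"
    by (rule finite_measure_Union) (use H in \<open>auto simp: sets_F\<close>)
  moreover have "{z. inner (z - x) u \<ge> 0} = {z. inner (z - x) u > 0} \<union> {z. inner (z - x) u = 0}"
    by auto
  ultimately have "measure F {z. inner (z - x) u \<ge> 0} = measure F {z. inner (z - x) u > 0}"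
    using z by simp
  also have "{z. inner (z - x) u > 0} = space F - {z. inner (z - x) u \<le> 0}"
    by (auto simp: space_F)
  also have "measure F \<dots> = 1 - measure F {z. inner (z - x) u \<le> 0}"
    by (rule prob_compl) (simp add: sets_F sets_tip_sublevel)
  finally show ?thesis .
qed

text \<open>A cone whose tip is not above the hyperplane through \<open>x\<close> meets the upper half-space at most in \<open>x\<close>.\<close>

lemma half_depth_nonpos:
  assumes "T > 0" "s \<le> 0"
  shows "half_depth T F x u s = 0"
proof -
  have "{z. inner (z - x) u \<ge> 0 \<and> tip_height T u (z - x) \<le> s} \<subseteq> {x}"
  proof clarify
    fix z assume z: "inner (z - x) u \<ge> 0" "tip_height T u (z - x) \<le> s"
    have "0 \<le> norm (z - x - inner (z - x) u *\<^sub>R u) / T" using assms by simp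
    then have "inner (z - x) u = 0" "norm (z - x - inner (z - x) u *\<^sub>R u) / T = 0"
      using z assms unfolding tip_height_def by linarith+
    then show "z = x" using assms by simp
  qed
  then have "measure F {z. inner (z - x) u \<ge> 0 \<and> tip_height T u (z - x) \<le> s} \<le> measure F {x}"
    by (intro finite_measure_mono) (auto simp: sets_F)
  also have "\<dots> = 0" by (rule null) auto
  finally have "measure F {z. inner (z - x) u \<ge> 0 \<and> tip_height T u (z - x) \<le> s} = 0"
    by (simp add: measure_le_0_iff)
  then show ?thesis by (simp add: half_depth_def)
qed

lemma depth_fun_eq_sum:
  assumes \<alpha>: "0 < \<alpha>" "\<alpha> < pi" and u: "norm u = 1"
  shows "depth_fun \<alpha> F x u s =
    half_depth (tan (\<alpha> / 2)) F x u s + half_depth (tan (\<alpha> / 2)) F x (- u) (- s)"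
proof (cases "s \<ge> 0")
  case True
  then show ?thesis
    using half_angle_pos(3)[OF \<alpha>] by (simp add: depth_fun_eq_half_depth[OF assms] half_depth_nonpos)
next
  case False
  then show ?thesis
    using half_angle_pos(3)[OF \<alpha>] u
    by (simp add: depth_fun_uminus depth_fun_eq_half_depth[OF \<alpha>] half_depth_nonpos)
qed

lemma continuous_depth_fun:
  assumes "0 < \<alpha>" "\<alpha> < pi" "norm u = 1"
  shows "continuous_on UNIV (depth_fun \<alpha> F x u)"
proof -
  have "continuous_on UNIV (half_depth (tan (\<alpha> / 2)) F x u)"
    "continuous_on UNIV (half_depth (tan (\<alpha> / 2)) F x (- u))"
    using half_angle_pos(3)[OF assms(1,2)] assms(3) by (auto intro: continuous_half_depth)
  note half = this
  have "continuous_on UNIV (\<lambda>s::real. - s)" by (intro continuous_intros)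
  then have "continuous_on UNIV (\<lambda>s. half_depth (tan (\<alpha> / 2)) F x (- u) (- s))"
    by (rule continuous_on_compose2[OF half(2)]) simp
  with half(1) have "continuous_on UNIV
      (\<lambda>s. half_depth (tan (\<alpha> / 2)) F x u s + half_depth (tan (\<alpha> / 2)) F x (- u) (- s))"
    by (rule continuous_on_add)
  moreover have "depth_fun \<alpha> F x u =
      (\<lambda>s. half_depth (tan (\<alpha> / 2)) F x u s + half_depth (tan (\<alpha> / 2)) F x (- u) (- s))"
    by (rule ext) (rule depth_fun_eq_sum[OF assms])
  ultimately show ?thesis by simp
qed

lemma depth_fun_degenerate:
  assumes "norm u = 1" and "DIM('a) \<ge> 2"
  shows "depth_fun 0 F x u s = 0"
proof -
  have "negligible (cone_A 0 x u s)"
    using negligible_cone_degenerate[OF assms] by (rule negligible_subset) (auto simp: cone_A_def)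
  then have "measure F (cone_A 0 x u s) = 0"
    by (rule null[OF borel_closed[OF closed_cone_A]])
  then show ?thesis by (simp add: depth_fun_def)
qed

text \<open>As the tip goes to infinity, the two parts of the cone increase to the two half-spaces.\<close>

lemma half_depth_exhausts:
  assumes t: "t < halfspace_depth F x u"
  shows "\<exists>s\<ge>0. t < half_depth T F x u s"
proof -
  have lim: "(\<lambda>n. measure F {z. z \<in> S \<and> tip_height T u (z - x) \<le> real n}) \<longlonglongrightarrow> measure F S"
    if S: "closed S" for S
  proof -
    have "(\<lambda>n. measure F {z. z \<in> S \<and> tip_height T u (z - x) \<le> real n}) \<longlonglongrightarrow>
        measure F (\<Union>n. {z. z \<in> S \<and> tip_height T u (z - x) \<le> real n})"
    proof (rule finite_Lim_measure_incseq)
      have "closed {z. z \<in> S \<and> tip_height T u (z - x) \<le> real n}" for n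
        using S by (auto intro!: closed_Collect_conj closed_Collect_le continuous_intros)
      then show "range (\<lambda>n. {z. z \<in> S \<and> tip_height T u (z - x) \<le> real n}) \<subseteq> sets F"
        by (auto simp: sets_F)
      show "incseq (\<lambda>n. {z. z \<in> S \<and> tip_height T u (z - x) \<le> real n})"
        by (force simp: incseq_def)
    qed
    also have "(\<Union>n. {z. z \<in> S \<and> tip_height T u (z - x) \<le> real n}) = S"
      by (auto intro: real_arch_simple)
    finally show ?thesis .
  qed
  have cl: "closed {z. inner (z - x) u \<ge> 0}" "closed {z. inner (z - x) u \<le> 0}"
    by (auto intro!: closed_Collect_le continuous_intros)
  have "(\<lambda>n. half_depth T F x u (real n)) \<longlonglongrightarrow> halfspace_depth F x u"
    using tendsto_min[OF lim[OF cl(1)] lim[OF cl(2)]]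
    unfolding half_depth_def halfspace_depth_def by simp
  then have "\<forall>\<^sub>F n in sequentially. t < half_depth T F x u (real n)"
    using t by (rule order_tendstoD(1))
  then obtain n where "t < half_depth T F x u (real n)"
    by (meson eventually_happens trivial_limit_sequentially)
  then show ?thesis by (intro exI[of _ "real n"]) simp
qed

end

lemma abs_cont_law_density:
  assumes "prob_space F" "f \<in> borel_measurable borel" "F = density lborel (\<lambda>y. ennreal (f y))"
  shows "abs_cont_law F"
proof -
  interpret prob_space F by fact
  show ?thesis
  proof
    show "sets F = sets borel" using assms by simp
    fix S :: "'a set" assume S: "S \<in> sets borel" "negligible S"
    then have "S \<in> null_sets lborel"
      by (simp add: negligible_iff_null_sets null_sets_completion_iff)
    then have "AE y in lborel. y \<notin> S" by (rule AE_not_in)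
    then have "S \<in> null_sets F"
      using S assms by (subst assms(3)) (subst null_sets_density_iff; auto)
    then show "measure F S = 0" by (simp add: measure_def null_setsD1)
  qed
qed

locale positive_law = abs_cont_law +
  assumes open_pos: "\<And>S. open S \<Longrightarrow> S \<noteq> {} \<Longrightarrow> measure F S > 0"
begin

lemma measure_strict_mono_open:
  assumes "A \<in> sets borel" "B \<in> sets borel" "A \<subseteq> B" "open S" "S \<noteq> {}" "S \<subseteq> B - A"
  shows "measure F A < measure F B"
proof -
  have "0 < measure F S" using assms open_pos by blast
  also have "\<dots> \<le> measure F (B - A)"
    using assms by (intro finite_measure_mono) (auto simp: sets_F)
  also have "\<dots> = measure F B - measure F A"
    using assms by (intro finite_measure_Diff) (auto simp: sets_F)
  finally show ?thesis by simp
qed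

text \<open>Both parts of the cone gain a nonempty open set when the tip moves from \<open>s\<close> to \<open>s'\<close>: above the
  hyperplane it contains a point of the axis, below it a point away from the axis, and the latter
  requires a direction \<open>e\<close> orthogonal to \<open>u\<close>.\<close>

lemma half_depth_strict_mono:
  assumes T: "T > 0" and u: "norm u = 1" and dim: "DIM('a) \<ge> 2" and s: "0 \<le> s" "s < s'"
  shows "half_depth T F x u s < half_depth T F x u s'"
proof -
  obtain e0 where e0: "e0 \<noteq> 0" "orthogonal u e0"
    using orthogonal_to_vector_exists[OF dim, of u] by blast
  define e where "e = e0 /\<^sub>R norm e0"
  have e: "norm e = 1" "inner u e = 0" "inner e u = 0"
    using e0 by (auto simp: e_def orthogonal_def inner_commute)
  have uu: "inner u u = 1" using u by (simp add: dot_square_norm)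
  define m where "m = (s + s') / 2"
  have m: "0 < m" "s < m" "m < s'" using s by (auto simp: m_def)
  have op: "open {z. inner (z - x) u > 0 \<and> s < tip_height T u (z - x) \<and> tip_height T u (z - x) < s'}"
    "open {z. inner (z - x) u < 0 \<and> s < tip_height T u (z - x) \<and> tip_height T u (z - x) < s'}"
    by (auto intro!: open_Collect_conj open_Collect_less continuous_intros)
  have "x + m *\<^sub>R u \<in> {z. inner (z - x) u > 0 \<and> s < tip_height T u (z - x) \<and> tip_height T u (z - x) < s'}"
    using m uu by (simp add: tip_height_def)
  then have neA: "{z. inner (z - x) u > 0 \<and> s < tip_height T u (z - x) \<and> tip_height T u (z - x) < s'} \<noteq> {}"
    by blast
  have A: "measure F {z. inner (z - x) u \<ge> 0 \<and> tip_height T u (z - x) \<le> s}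
      < measure F {z. inner (z - x) u \<ge> 0 \<and> tip_height T u (z - x) \<le> s'}"
    using s by (intro measure_strict_mono_open[OF sets_tip_sublevel(1) sets_tip_sublevel(1) _ op(1) neA]) auto
  \<comment> \<open>At height \<open>- 1\<close>, a point at distance \<open>T * (1 + m)\<close> from the axis has tip height \<open>m\<close>.\<close>
  have "inner (- u + (T * (1 + m)) *\<^sub>R e) u = - 1" using e uu by (simp add: inner_diff_left)
  moreover have "norm (- u + (T * (1 + m)) *\<^sub>R e - (-1) *\<^sub>R u) = T * (1 + m)"
    using e T m by (simp add: abs_mult)
  ultimately have "x + (- u + (T * (1 + m)) *\<^sub>R e) \<in>
      {z. inner (z - x) u < 0 \<and> s < tip_height T u (z - x) \<and> tip_height T u (z - x) < s'}"
    using m T by (simp add: tip_height_def)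
  then have neB: "{z. inner (z - x) u < 0 \<and> s < tip_height T u (z - x) \<and> tip_height T u (z - x) < s'} \<noteq> {}"
    by blast
  have B: "measure F {z. inner (z - x) u \<le> 0 \<and> tip_height T u (z - x) \<le> s}
      < measure F {z. inner (z - x) u \<le> 0 \<and> tip_height T u (z - x) \<le> s'}"
    using s by (intro measure_strict_mono_open[OF sets_tip_sublevel(2) sets_tip_sublevel(2) _ op(2) neB]) auto
  show ?thesis using A B unfolding half_depth_def by (auto simp: min_def)
qed

lemma half_depth_less_halfspace_depth:
  assumes T: "T > 0" and u: "norm u = 1" and dim: "DIM('a) \<ge> 2" and s: "0 \<le> s"
  shows "half_depth T F x u s < halfspace_depth F x u"
proof -
  have "half_depth T F x u s < half_depth T F x u (s + 1)"
    using half_depth_strict_mono[OF T u dim s, of "s + 1"] by simp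
  also have "\<dots> \<le> halfspace_depth F x u"
    unfolding half_depth_def halfspace_depth_def
    by (intro min.mono finite_measure_mono) (auto simp: sets_F sets_tip_sublevel)
  finally show ?thesis .
qed

end

lemma positive_law_density:
  assumes "prob_space F" "f \<in> borel_measurable borel" "F = density lborel (\<lambda>y. ennreal (f y))"
    and pos: "\<And>y. f y > 0"
  shows "positive_law F"
proof -
  interpret abs_cont_law F using assms(1-3) by (rule abs_cont_law_density)
  show ?thesis
  proof
    fix S :: "'a set" assume S: "open S" "S \<noteq> {}"
    show "measure F S > 0"
    proof (rule ccontr)
      assume "\<not> measure F S > 0"
      then have "measure F S = 0" by (simp add: zero_less_measure_iff)
      then have "S \<in> null_sets F" using S by (auto simp: emeasure_eq_measure sets_F)
      then have "AE y in lborel. y \<in> S \<longrightarrow> ennreal (f y) = 0"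
        using assms(2) by (subst (asm) assms(3)) (simp add: null_sets_density_iff)
      then have "AE y in lborel. y \<notin> S"
        by (rule AE_mp) (intro AE_I2, use pos in \<open>metis ennreal_eq_0_iff not_le\<close>)
      then have "S \<in> null_sets lborel" using S by (simp add: AE_iff_null_sets)
      then have "negligible S"
        using S by (simp add: negligible_iff_null_sets null_sets_completion_iff)
      then show False using S open_not_negligible by blast
    qed
  qed
qed

section \<open>Quantiles of valley-shaped functions\<close>

text \<open>The shape of the depth function along a line: it decreases strictly to \<open>0\<close> at \<open>s = 0\<close>, then increases
  strictly, and approaches \<open>m\<close> on both sides without attaining it.\<close>

locale valley = positive_law G for G :: "real measure" +
  fixes D :: "real \<Rightarrow> real" and m :: real
  assumes cont: "continuous_on UNIV D"
    and zero: "D 0 = 0"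
    and incr: "\<And>s s'. 0 \<le> s \<Longrightarrow> s < s' \<Longrightarrow> D s < D s'"
    and decr: "\<And>s s'. s < s' \<Longrightarrow> s' \<le> 0 \<Longrightarrow> D s' < D s"
    and bound: "\<And>s. D s < m"
    and reach_right: "\<And>t. t < m \<Longrightarrow> \<exists>s\<ge>0. t < D s"
    and reach_left: "\<And>t. t < m \<Longrightarrow> \<exists>s\<le>0. t < D s"
begin

definition sublevel_mass :: "real \<Rightarrow> real" where "sublevel_mass t = measure G {s. D s \<le> t}"

definition quantile :: "real \<Rightarrow> real" where "quantile \<delta> = Inf {t. t \<ge> 0 \<and> sublevel_mass t \<ge> \<delta>}"

lemma m_pos: "m > 0"
  using bound[of 0] zero by simp

lemma D_nonneg: "D s \<ge> 0"
  using incr[of 0 s] decr[of s 0] zero by (cases s "0 :: real" rule: linorder_cases) auto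

lemma D_pos: "s \<noteq> 0 \<Longrightarrow> D s > 0"
  using incr[of 0 s] decr[of s 0] zero by (cases s "0 :: real" rule: linorder_cases) auto

lemma open_sublevel: "open {s. t < D s \<and> D s < t'}"
  by (auto intro!: open_Collect_conj open_Collect_less cont continuous_on_const)

lemma sets_sublevel: "{s. D s \<le> t} \<in> sets borel"
  by (intro borel_closed closed_Collect_le cont continuous_on_const)

lemma hits_right: "0 \<le> t \<Longrightarrow> t < m \<Longrightarrow> \<exists>b\<ge>0. D b = t"
proof -
  assume t: "0 \<le> t" "t < m"
  obtain s where s: "s \<ge> 0" "t < D s" using reach_right[OF t(2)] by blast
  have "\<exists>b. 0 \<le> b \<and> b \<le> s \<and> D b = t"
    by (rule IVT') (use s t zero cont in \<open>auto intro: continuous_on_subset\<close>)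
  then show ?thesis by blast
qed

lemma hits_left: "0 \<le> t \<Longrightarrow> t < m \<Longrightarrow> \<exists>a\<le>0. D a = t"
proof -
  assume t: "0 \<le> t" "t < m"
  obtain s where s: "s \<le> 0" "t < D s" using reach_left[OF t(2)] by blast
  have "\<exists>a. s \<le> a \<and> a \<le> 0 \<and> D a = t"
    by (rule IVT2') (use s t zero cont in \<open>auto intro: continuous_on_subset\<close>)
  then show ?thesis by blast
qed

lemma sublevel_eq_Icc:
  assumes ab: "a \<le> 0" "0 \<le> b" "D a = t" "D b = t"
  shows "{s. D s \<le> t} = {a..b}"
proof -
  have "D s \<le> t \<longleftrightarrow> a \<le> s \<and> s \<le> b" for s
  proof (cases "s \<ge> 0")
    case True
    then show ?thesis using ab incr[of b s] incr[of s b] by (cases s b rule: linorder_cases) auto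
  next
    case False
    then show ?thesis using ab decr[of a s] decr[of s a] by (cases s a rule: linorder_cases) auto
  qed
  then show ?thesis by (simp add: set_eq_iff)
qed

text \<open>A level set has at most one point on each side of \<open>0\<close>.\<close>

lemma measure_level: "measure G {s. D s = t} = 0"
proof -
  have "inj_on D {0..}"
    by (rule inj_onI) (metis atLeast_iff incr less_irrefl linorder_less_linear)
  moreover have "inj_on D {..0}"
    by (rule inj_onI) (metis atMost_iff decr less_irrefl linorder_less_linear)
  ultimately have "finite (D -` {t} \<inter> {0..})" "finite (D -` {t} \<inter> {..0})"
    by (auto intro: finite_vimage_IntI)
  then have "finite ((D -` {t} \<inter> {0..}) \<union> (D -` {t} \<inter> {..0}))" by simp
  moreover have "(D -` {t} \<inter> {0..}) \<union> (D -` {t} \<inter> {..0}) = {s. D s = t}" by auto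
  ultimately have "finite {s. D s = t}" by simp
  then show ?thesis by (intro null negligible_finite) (auto intro: borel_closed finite_imp_closed)
qed

lemma continuous_sublevel_mass: "continuous_on UNIV sublevel_mass"
proof -
  have "D \<in> borel_measurable G"
    unfolding measurable_cong_sets[OF sets_F refl] using cont by (rule borel_measurable_continuous_onI)
  then have "continuous_on UNIV (\<lambda>t. measure G {s \<in> space G. D s \<le> t})"
    using measure_level by (intro continuous_on_measure_sublevel finite_measure_axioms sets.top) (auto simp: space_F)
  then show ?thesis by (simp add: sublevel_mass_def[abs_def] space_F)
qed

lemma sublevel_mass_0: "sublevel_mass 0 = 0"
proof -
  have "{s. D s \<le> 0} = {s. D s = 0}" using D_nonneg by (auto intro: antisym)
  then show ?thesis by (simp add: sublevel_mass_def measure_level)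
qed

lemma sublevel_mass_m: "sublevel_mass m = 1"
proof -
  have "{s. D s \<le> m} = space G" using bound by (auto simp: space_F intro: less_imp_le)
  then show ?thesis by (simp add: sublevel_mass_def prob_space)
qed

lemma sublevel_mass_strict_mono:
  assumes t: "0 \<le> t" "t < t'" "t' \<le> m"
  shows "sublevel_mass t < sublevel_mass t'"
proof -
  \<comment> \<open>The value \<open>(t + t') / 2\<close> is attained, so the open set of points with value strictly between \<open>t\<close> and \<open>t'\<close> is nonempty.\<close>
  have "0 \<le> (t + t') / 2" "(t + t') / 2 < m" using t by auto
  then obtain b where "D b = (t + t') / 2" using hits_right by blast
  then have "b \<in> {s. t < D s \<and> D s < t'}" using t by simp
  then have "{s. t < D s \<and> D s < t'} \<noteq> {}" by blast
  then show ?thesis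
    unfolding sublevel_mass_def using t
    by (intro measure_strict_mono_open[OF sets_sublevel sets_sublevel _ open_sublevel]) auto
qed

lemma sublevel_mass_surj:
  assumes "0 \<le> \<delta>" "\<delta> \<le> 1"
  shows "\<exists>t. 0 \<le> t \<and> t \<le> m \<and> sublevel_mass t = \<delta>"
  by (rule IVT') (use assms sublevel_mass_0 sublevel_mass_m m_pos continuous_sublevel_mass in \<open>auto intro: continuous_on_subset\<close>)

lemma quantile_sublevel_mass:
  assumes t: "0 \<le> t" "t \<le> m"
  shows "quantile (sublevel_mass t) = t"
  unfolding quantile_def
proof (rule cInf_eq_minimum)
  show "t \<in> {t'. 0 \<le> t' \<and> sublevel_mass t \<le> sublevel_mass t'}" using t by simp
  fix t' assume t': "t' \<in> {t'. 0 \<le> t' \<and> sublevel_mass t \<le> sublevel_mass t'}"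
  show "t \<le> t'"
  proof (rule ccontr)
    assume "\<not> t \<le> t'"
    then have "sublevel_mass t' < sublevel_mass t" using sublevel_mass_strict_mono[of t' t] t t' by simp
    then show False using t' by simp
  qed
qed

lemma sublevel_mass_quantile:
  assumes "0 \<le> \<delta>" "\<delta> \<le> 1"
  shows "sublevel_mass (quantile \<delta>) = \<delta>" "0 \<le> quantile \<delta>" "quantile \<delta> \<le> m"
  using sublevel_mass_surj[OF assms] quantile_sublevel_mass by auto

lemma quantile_0: "quantile 0 = 0"
  using quantile_sublevel_mass[of 0] sublevel_mass_0 m_pos by simp

lemma quantile_1: "quantile 1 = m"
  using quantile_sublevel_mass[of m] sublevel_mass_m m_pos by simp

lemma quantile_strict_mono: "strict_mono_on {0..1} quantile"
proof (rule strict_mono_onI)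
  fix \<delta> \<delta>' :: real assume d: "\<delta> \<in> {0..1}" "\<delta>' \<in> {0..1}" "\<delta> < \<delta>'"
  show "quantile \<delta> < quantile \<delta>'"
  proof (rule ccontr)
    assume "\<not> quantile \<delta> < quantile \<delta>'"
    then have "sublevel_mass (quantile \<delta>') \<le> sublevel_mass (quantile \<delta>)"
      using d sublevel_mass_strict_mono[of "quantile \<delta>'" "quantile \<delta>"] sublevel_mass_quantile[of \<delta>] sublevel_mass_quantile[of \<delta>'] by (cases "quantile \<delta>' = quantile \<delta>") auto
    then show False using d sublevel_mass_quantile(1)[of \<delta>] sublevel_mass_quantile(1)[of \<delta>'] by simp
  qed
qed

text \<open>Since \<open>0 < quantile \<delta> < m\<close>, both branches of the valley attain the value \<open>quantile \<delta>\<close>.\<close>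

lemma quantile_interval:
  assumes \<delta>: "0 < \<delta>" "\<delta> < 1"
  shows "\<exists>a b. a < 0 \<and> 0 < b \<and> {s. D s \<le> quantile \<delta>} = {a..b} \<and> D a = quantile \<delta> \<and> D b = quantile \<delta> \<and>
    measure G {a..b} = \<delta>"
proof -
  have inside: "0 < quantile \<delta>" "quantile \<delta> < m"
    using quantile_strict_mono \<delta> quantile_0 quantile_1 strict_mono_onD[of "{0..1}" quantile 0 \<delta>] strict_mono_onD[of "{0..1}" quantile \<delta> 1]
    by auto
  obtain b where b: "b \<ge> 0" "D b = quantile \<delta>" using hits_right[of "quantile \<delta>"] inside by auto
  obtain a where a: "a \<le> 0" "D a = quantile \<delta>" using hits_left[of "quantile \<delta>"] inside by auto
  have "a \<noteq> 0" "b \<noteq> 0" using a b inside zero by auto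
  moreover have "{s. D s \<le> quantile \<delta>} = {a..b}" using sublevel_eq_Icc a b by blast
  moreover have "measure G {s. D s \<le> quantile \<delta>} = \<delta>" using sublevel_mass_quantile(1)[of \<delta>] \<delta> by (simp add: sublevel_mass_def)
  ultimately show ?thesis using a b by (intro exI[of _ a] exI[of _ b]) auto
qed

text \<open>Continuity of the quantile function at \<open>0\<close>, read off from the values at the points
  \<open>sublevel_mass \<eta>\<close>.\<close>

lemma quantile_small:
  assumes "\<epsilon> > 0"
  shows "\<forall>\<^sub>F \<delta> in at_right 0. quantile \<delta> < \<epsilon>"
proof -
  define \<eta> where "\<eta> = min \<epsilon> m"
  have \<eta>: "0 < \<eta>" "\<eta> \<le> m" "\<eta> \<le> \<epsilon>" using assms m_pos by (auto simp: \<eta>_def)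
  have mass: "0 < sublevel_mass \<eta>" "sublevel_mass \<eta> \<le> 1"
    using sublevel_mass_strict_mono[of 0 \<eta>] sublevel_mass_0 \<eta> by (auto simp: sublevel_mass_def)
  have "\<forall>\<^sub>F \<delta> in at_right 0. \<delta> < sublevel_mass \<eta>"
    using mass(1) eventually_at_right_field by blast
  moreover have "\<forall>\<^sub>F \<delta>::real in at_right 0. 0 < \<delta>" by (rule eventually_at_right_less)
  ultimately show ?thesis
  proof eventually_elim
    case (elim \<delta>)
    then have "quantile \<delta> < quantile (sublevel_mass \<eta>)"
      using mass by (intro strict_mono_onD[OF quantile_strict_mono]) auto
    then show ?case using quantile_sublevel_mass[of \<eta>] \<eta> by simp
  qed
qed

text \<open>Write \<open>[a, b]\<close> for the sublevel interval of mass \<open>\<delta>\<close> and \<open>\<rho> = root d (quantile \<delta>)\<close>. As \<open>\<delta>\<close> tends to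
  \<open>0\<close> both end points do, so \<open>b / \<rho>\<close> and \<open>- a / \<rho>\<close> tend to \<open>1 / root d c\<close> and \<open>\<delta> / (b - a)\<close> to \<open>k\<close>.
  Multiplying, \<open>\<delta> / \<rho>\<close> tends to \<open>2 k / root d c\<close>, and the claim is the \<open>d\<close>-th power of the
  reciprocal.\<close>

lemma quantile_asymptotics:
  assumes d: "d > 0" and k: "k > 0"
    and right: "((\<lambda>s. D s / s ^ d) \<longlongrightarrow> c) (at_right 0)"
    and left: "((\<lambda>s. D (- s) / s ^ d) \<longlongrightarrow> c) (at_right 0)"
    and c_pos: "c > 0"
    and dens: "\<And>\<epsilon>. \<epsilon> > 0 \<Longrightarrow> \<exists>\<eta>>0. \<forall>a b. a < 0 \<longrightarrow> 0 < b \<longrightarrow> b - a < \<eta> \<longrightarrow>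
        \<bar>measure G {a..b} - k * (b - a)\<bar> \<le> \<epsilon> * (b - a)"
  shows "((\<lambda>\<delta>. quantile \<delta> / \<delta> ^ d) \<longlongrightarrow> c / (2 * k) ^ d) (at_right 0)"
proof -
  have "\<forall>\<delta>. \<exists>a b. 0 < \<delta> \<and> \<delta> < 1 \<longrightarrow> a < 0 \<and> 0 < b \<and> D a = quantile \<delta> \<and> D b = quantile \<delta> \<and> measure G {a..b} = \<delta>"
    using quantile_interval by blast
  then obtain a b where ab: "\<And>\<delta>. 0 < \<delta> \<and> \<delta> < 1 \<Longrightarrow> a \<delta> < 0 \<and> 0 < b \<delta> \<and> D (a \<delta>) = quantile \<delta> \<and>
      D (b \<delta>) = quantile \<delta> \<and> measure G {a \<delta>..b \<delta>} = \<delta>"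
    by metis
  have ev: "\<forall>\<^sub>F \<delta>::real in at_right 0. 0 < \<delta> \<and> \<delta> < 1"
    by (intro eventually_conj eventually_at_right_less) (auto simp: eventually_at_right_field intro: exI[of _ 1])
  have small: "\<forall>\<^sub>F \<delta> in at_right 0. b \<delta> < e \<and> - a \<delta> < e" if e: "e > 0" for e
  proof -
    have "\<forall>\<^sub>F \<delta> in at_right 0. quantile \<delta> < min (D e) (D (- e))"
      using e D_pos by (intro quantile_small) auto
    with ev show ?thesis
    proof eventually_elim
      case (elim \<delta>)
      then show ?case
        using ab[of \<delta>] e incr[of e "b \<delta>"] decr[of "a \<delta>" "- e"]
        by (cases "b \<delta> = e"; cases "a \<delta> = - e") (auto simp: not_less[symmetric], (smt (verit))+)
    qed
  qed
  have b0: "filterlim b (at_right 0) (at_right 0)"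
    unfolding filterlim_at
  proof
    show "\<forall>\<^sub>F \<delta> in at_right 0. b \<delta> \<in> {0<..} \<and> b \<delta> \<noteq> 0"
      using ev by eventually_elim (use ab in \<open>metis greaterThan_iff less_irrefl\<close>)
    show "(b \<longlongrightarrow> 0) (at_right 0)"
    proof (rule tendstoI)
      fix e :: real assume "e > 0"
      from small[OF this] ev show "\<forall>\<^sub>F \<delta> in at_right 0. dist (b \<delta>) 0 < e"
        by eventually_elim (use ab in force)
    qed
  qed
  have a0: "filterlim (\<lambda>\<delta>. - a \<delta>) (at_right 0) (at_right 0)"
    unfolding filterlim_at
  proof
    show "\<forall>\<^sub>F \<delta> in at_right 0. - a \<delta> \<in> {0<..} \<and> - a \<delta> \<noteq> 0"
      using ev by eventually_elim (use ab in \<open>metis greaterThan_iff less_irrefl neg_0_less_iff_less\<close>)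
    show "((\<lambda>\<delta>. - a \<delta>) \<longlongrightarrow> 0) (at_right 0)"
    proof (rule tendstoI)
      fix e :: real assume "e > 0"
      from small[OF this] ev show "\<forall>\<^sub>F \<delta> in at_right 0. dist (- a \<delta>) 0 < e"
        by eventually_elim (use ab in force)
    qed
  qed
  define \<kappa> where "\<kappa> = root d c"
  define \<rho> where "\<rho> \<delta> = root d (quantile \<delta>)" for \<delta>
  have \<kappa>: "\<kappa> > 0" "\<kappa> ^ d = c" using d c_pos by (auto simp: \<kappa>_def)
  have "((\<lambda>\<delta>. inverse (root d (D (b \<delta>) / b \<delta> ^ d))) \<longlongrightarrow> inverse \<kappa>) (at_right 0)"
    unfolding \<kappa>_def using filterlim_compose[OF right b0] d c_pos
    by (intro tendsto_inverse tendsto_real_root) auto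
  then have lb: "((\<lambda>\<delta>. b \<delta> / \<rho> \<delta>) \<longlongrightarrow> inverse \<kappa>) (at_right 0)"
  proof (rule Lim_transform_eventually)
    show "\<forall>\<^sub>F \<delta> in at_right 0. inverse (root d (D (b \<delta>) / b \<delta> ^ d)) = b \<delta> / \<rho> \<delta>"
      using ev by eventually_elim
        (use ab d in \<open>auto simp: \<rho>_def real_root_divide real_root_power_cancel less_imp_le\<close>)
  qed
  have "((\<lambda>\<delta>. inverse (root d (D (- (- a \<delta>)) / (- a \<delta>) ^ d))) \<longlongrightarrow> inverse \<kappa>) (at_right 0)"
    unfolding \<kappa>_def using filterlim_compose[OF left a0] d c_pos
    by (intro tendsto_inverse tendsto_real_root) auto
  then have la: "((\<lambda>\<delta>. - a \<delta> / \<rho> \<delta>) \<longlongrightarrow> inverse \<kappa>) (at_right 0)"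
  proof (rule Lim_transform_eventually)
    show "\<forall>\<^sub>F \<delta> in at_right 0. inverse (root d (D (- (- a \<delta>)) / (- a \<delta>) ^ d)) = - a \<delta> / \<rho> \<delta>"
      using ev by eventually_elim
        (use ab d in \<open>auto simp: \<rho>_def real_root_divide real_root_power_cancel less_imp_le\<close>)
  qed
  have lG: "((\<lambda>\<delta>. \<delta> / (b \<delta> - a \<delta>)) \<longlongrightarrow> k) (at_right 0)"
  proof (rule tendstoI)
    fix e :: real assume e: "e > 0"
    then obtain \<eta> where \<eta>: "\<eta> > 0" "\<And>a b. a < 0 \<Longrightarrow> 0 < b \<Longrightarrow> b - a < \<eta> \<Longrightarrow>
        \<bar>measure G {a..b} - k * (b - a)\<bar> \<le> e / 2 * (b - a)"
      using dens[of "e / 2"] by auto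
    have "\<eta> / 2 > 0" using \<eta> by simp
    from small[OF this] ev show "\<forall>\<^sub>F \<delta> in at_right 0. dist (\<delta> / (b \<delta> - a \<delta>)) k < e"
    proof eventually_elim
      case (elim \<delta>)
      define l where "l = b \<delta> - a \<delta>"
      have l: "l > 0" "l < \<eta>" using elim ab[of \<delta>] by (auto simp: l_def)
      then have "\<bar>\<delta> - k * l\<bar> \<le> e / 2 * l" using \<eta>(2)[of "a \<delta>" "b \<delta>"] elim ab[of \<delta>] by (simp add: l_def)
      moreover have "\<delta> / l - k = (\<delta> - k * l) / l" using l by (simp add: field_simps)
      ultimately have "\<bar>\<delta> / l - k\<bar> \<le> e / 2"
        using l by (simp add: abs_divide pos_divide_le_eq)
      then show ?case using e by (simp add: dist_real_def l_def)
    qed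
  qed
  have "((\<lambda>\<delta>. \<delta> / (b \<delta> - a \<delta>) * (b \<delta> / \<rho> \<delta> + - a \<delta> / \<rho> \<delta>)) \<longlongrightarrow> k * (inverse \<kappa> + inverse \<kappa>)) (at_right 0)"
    by (intro tendsto_mult tendsto_add lG la lb)
  then have "((\<lambda>\<delta>. inverse (\<delta> / (b \<delta> - a \<delta>) * (b \<delta> / \<rho> \<delta> + - a \<delta> / \<rho> \<delta>)) ^ d) \<longlongrightarrow>
      inverse (k * (inverse \<kappa> + inverse \<kappa>)) ^ d) (at_right 0)"
    using k \<kappa> by (intro tendsto_power tendsto_inverse) auto
  then have "((\<lambda>\<delta>. quantile \<delta> / \<delta> ^ d) \<longlongrightarrow> inverse (k * (inverse \<kappa> + inverse \<kappa>)) ^ d) (at_right 0)"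
  proof (rule Lim_transform_eventually)
    show "\<forall>\<^sub>F \<delta> in at_right 0. inverse (\<delta> / (b \<delta> - a \<delta>) * (b \<delta> / \<rho> \<delta> + - a \<delta> / \<rho> \<delta>)) ^ d = quantile \<delta> / \<delta> ^ d"
      using ev
    proof eventually_elim
      case (elim \<delta>)
      have "quantile \<delta> > 0" using ab[of \<delta>] elim D_pos[of "b \<delta>"] by auto
      then have \<rho>: "\<rho> \<delta> > 0" "\<rho> \<delta> ^ d = quantile \<delta>" using d by (auto simp: \<rho>_def)
      have l: "b \<delta> - a \<delta> > 0" using elim ab[of \<delta>] by auto
      have "b \<delta> / \<rho> \<delta> + - a \<delta> / \<rho> \<delta> = (b \<delta> - a \<delta>) / \<rho> \<delta>" by (simp add: diff_divide_distrib)
      then have "inverse (\<delta> / (b \<delta> - a \<delta>) * (b \<delta> / \<rho> \<delta> + - a \<delta> / \<rho> \<delta>)) = \<rho> \<delta> / \<delta>"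
        using l by simp
      then show ?case using \<rho> by (simp add: power_divide)
    qed
  qed
  also have "inverse (k * (inverse \<kappa> + inverse \<kappa>)) = \<kappa> / (2 * k)"
    using k \<kappa> by (simp add: field_simps)
  finally show ?thesis using \<kappa> by (simp add: power_divide)
qed

end

section \<open>Lebesgue points and small cones\<close>

text \<open>Near a Lebesgue point the density may be replaced by its value, with an error small relative to
  the volume of a ball, on any set in that ball: the error is at most the integral of \<open>\<bar>h y - h x\<bar>\<close>
  over the ball. This serves both the cones in space and the sublevel intervals on the line.\<close>

lemma lebesgue_point_small_sets:
  fixes h :: "'a::euclidean_space \<Rightarrow> real"
  assumes int: "integrable lborel h" and lp: "lebesgue_point h x" and \<epsilon>: "\<epsilon> > 0"
  shows "\<exists>\<eta>>0. \<forall>r S. 0 < r \<longrightarrow> r < \<eta> \<longrightarrow> S \<in> sets borel \<longrightarrow> S \<subseteq> ball x r \<longrightarrow>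
    \<bar>(LINT y:S|lborel. h y) - h x * measure lborel S\<bar> \<le> \<epsilon> * r ^ DIM('a)"
proof -
  define v where "v = unit_ball_vol (real DIM('a))"
  have v: "v > 0" by (simp add: v_def)
  let ?avg = "\<lambda>r. (LINT y:ball x r|lborel. \<bar>h y - h x\<bar>) / measure lborel (ball x r)"
  have "\<forall>\<^sub>F r in at_right 0. ?avg r < \<epsilon> / v"
    using lp \<epsilon> v unfolding lebesgue_point_def by (intro order_tendstoD(2)) auto
  then obtain \<eta> where \<eta>: "\<eta> > 0" "\<And>r. 0 < r \<Longrightarrow> r < \<eta> \<Longrightarrow> ?avg r < \<epsilon> / v"
    unfolding eventually_at_right_field by auto
  have "\<bar>(LINT y:S|lborel. h y) - h x * measure lborel S\<bar> \<le> \<epsilon> * r ^ DIM('a)"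
    if r: "0 < r" "r < \<eta>" and S: "S \<in> sets borel" "S \<subseteq> ball x r" for r S
  proof -
    have bnd: "emeasure lborel A < \<infinity>" if "A \<subseteq> ball x r" for A
      using that emeasure_bounded_finite bounded_subset[OF bounded_ball] by blast
    have c: "set_integrable lborel A (\<lambda>_. h x)" if "A \<in> sets borel" "A \<subseteq> ball x r" for A
      using that bnd[of A] unfolding set_integrable_def
      by (intro integrable_scaleR_left integrable_real_indicator) auto
    have hi: "set_integrable lborel A h" if "A \<in> sets borel" for A
      using that int unfolding set_integrable_def
      by (intro integrable_mult_indicator) auto
    have d: "set_integrable lborel A (\<lambda>y. h y - h x)" if "A \<in> sets borel" "A \<subseteq> ball x r" for A
      using hi c that by (intro set_integral_diff) auto
    have "(LINT y:S|lborel. h y) - h x * measure lborel S = (LINT y:S|lborel. h y - h x)"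
      using set_integral_diff(2)[OF hi[OF S(1)] c[OF S]] bnd[OF S(2)] S
      by (simp add: set_lebesgue_integral_def mult.commute)
    also have "\<bar>\<dots>\<bar> \<le> (LINT y:S|lborel. \<bar>h y - h x\<bar>)"
      using set_integral_norm_bound[OF d[OF S]] by simp
    also have "\<dots> \<le> (LINT y:ball x r|lborel. \<bar>h y - h x\<bar>)"
      using S set_integrable_abs[OF d[OF S]] set_integrable_abs[OF d[of "ball x r"]]
      unfolding set_lebesgue_integral_def set_integrable_def
      by (intro integral_mono) (auto split: split_indicator)
    also have "\<dots> = ?avg r * measure lborel (ball x r)"
      using r content_ball_pos[of r x] by simp
    also have "\<dots> \<le> \<epsilon> / v * (v * r ^ DIM('a))"
      using \<eta>(2)[OF r] r content_ball[of r x] \<epsilon> unfolding v_def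
      by (intro mult_mono) auto
    also have "\<dots> = \<epsilon> * r ^ DIM('a)" using v by simp
    finally show ?thesis .
  qed
  with \<eta>(1) show ?thesis by blast
qed

lemma prob_density_lborel:
  assumes F: "prob_space F" and f: "f \<in> borel_measurable borel" "\<And>y. f y \<ge> 0" "F = density lborel (\<lambda>y. ennreal (f y))"
  shows "integrable lborel f"
    and "S \<in> sets borel \<Longrightarrow> measure F S = (LINT y:S|lborel. f y)"
proof -
  interpret prob_space F by fact
  have "integrable F (\<lambda>_. 1 :: real)" by simp
  then show "integrable lborel f"
    using f(1,2) by (subst (asm) f(3)) (subst (asm) integrable_density; simp)
  assume S: "S \<in> sets borel"
  then have "measure F S = (LINT y|F. indicator S y)"
    using f(3) by simp
  also have "\<dots> = (LINT y|lborel. f y * indicator S y)"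
    using f(1,2) S by (subst f(3)) (subst integral_density; simp)
  finally show "measure F S = (LINT y:S|lborel. f y)"
    by (simp add: set_lebesgue_integral_def mult.commute)
qed

text \<open>The part \<open>A s\<close> of the cone above the hyperplane lies in a ball of radius proportional to \<open>s\<close>, so its
  mass is asymptotic to \<open>f x\<close> times its volume. The part \<open>B s\<close> below keeps a mass bounded away from
  \<open>0\<close>, so for small \<open>s\<close> the minimum is attained by \<open>A s\<close>.\<close>

lemma half_depth_asymptotics:
  fixes f :: "real ^ 'n \<Rightarrow> real"
  assumes F: "prob_space F" and f: "f \<in> borel_measurable borel" "\<And>y. f y > 0" "F = density lborel (\<lambda>y. ennreal (f y))"
    and lp: "lebesgue_point f x" and T: "T > 0" and u: "norm u = 1"
  shows "((\<lambda>s. half_depth T F x u s / s ^ CARD('n)) \<longlongrightarrow>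
    f x * (unit_ball_vol (real (CARD('n) - 1)) * T ^ (CARD('n) - 1) / real CARD('n))) (at_right 0)"
proof -
  interpret positive_law F using F f(1,3,2) by (rule positive_law_density)
  define d where "d = CARD('n)"
  have d: "d > 0" by (simp add: d_def)
  define V where "V = unit_ball_vol (real (d - 1)) * T ^ (d - 1) / real d"
  define A where "A s = {z. inner (z - x) u \<ge> 0 \<and> tip_height T u (z - x) \<le> s}" for s
  define B where "B s = {z. inner (z - x) u \<le> 0 \<and> tip_height T u (z - x) \<le> s}" for s
  have sets: "A s \<in> sets borel" "B s \<in> sets borel" for s
    unfolding A_def B_def by (rule sets_tip_sublevel)+
  define L where "L = 2 + T"
  have L: "L > 0" using T by (simp add: L_def)
  have A_ball: "A s \<subseteq> ball x (L * s)" if s: "s > 0" for s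
  proof
    fix z assume "z \<in> A s"
    then have z: "inner (z - x) u \<ge> 0" "inner (z - x) u + norm (z - x - inner (z - x) u *\<^sub>R u) / T \<le> s"
      by (auto simp: A_def tip_height_def)
    define h where "h = inner (z - x) u"
    define r where "r = norm (z - x - h *\<^sub>R u)"
    have "0 \<le> r / T" using T by (simp add: r_def)
    with z have "h \<ge> 0" "h \<le> s" "r / T \<le> s" unfolding h_def[symmetric] r_def[symmetric] by linarith+
    then have "r \<le> T * s" using T by (simp add: pos_divide_le_eq mult.commute)
    have "norm (z - x) \<le> norm (h *\<^sub>R u) + r"
      unfolding r_def by (metis norm_triangle_sub add.commute)
    also have "\<dots> \<le> s + T * s" using \<open>h \<ge> 0\<close> \<open>h \<le> s\<close> \<open>r \<le> T * s\<close> u by simp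
    also have "\<dots> < L * s" using s by (simp add: L_def algebra_simps)
    finally show "z \<in> ball x (L * s)" by (simp add: dist_norm norm_minus_commute)
  qed
  have limA: "((\<lambda>s. measure F (A s) / s ^ d) \<longlongrightarrow> f x * V) (at_right 0)"
  proof (rule tendstoI)
    fix e :: real assume e: "e > 0"
    define \<epsilon> where "\<epsilon> = e / 2 / L ^ d"
    have "\<epsilon> > 0" using e L by (simp add: \<epsilon>_def)
    then obtain \<eta> where \<eta>: "\<eta> > 0" "\<And>r S. 0 < r \<Longrightarrow> r < \<eta> \<Longrightarrow> S \<in> sets borel \<Longrightarrow> S \<subseteq> ball x r \<Longrightarrow>
        \<bar>(LINT y:S|lborel. f y) - f x * measure lborel S\<bar> \<le> \<epsilon> * r ^ d"
      using lebesgue_point_small_sets[OF prob_density_lborel(1)[OF F f(1) _ f(3)] lp, of \<epsilon>] f(2)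
      by (auto simp: d_def less_imp_le)
    have "dist (measure F (A s) / s ^ d) (f x * V) < e" if s: "0 < s" "s < \<eta> / L" for s
    proof -
      have "measure F (A s) = (LINT y:A s|lborel. f y)"
        using prob_density_lborel(2)[OF F f(1) _ f(3) sets(1)] f(2) by (simp add: less_imp_le)
      moreover have "measure lborel (A s) = V * s ^ d"
        using measure_cone_tip[OF u T, of s x] s by (simp add: A_def V_def d_def)
      moreover have "L * s < \<eta>" using s L by (simp add: field_simps)
      ultimately have "\<bar>measure F (A s) - f x * (V * s ^ d)\<bar> \<le> \<epsilon> * (L * s) ^ d"
        using \<eta>(2)[of "L * s" "A s"] s L sets A_ball by simp
      also have "\<dots> = e / 2 * s ^ d" using L by (simp add: \<epsilon>_def power_mult_distrib)
      finally have "\<bar>measure F (A s) - f x * (V * s ^ d)\<bar> \<le> e / 2 * s ^ d" .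
      moreover have "measure F (A s) / s ^ d - f x * V = (measure F (A s) - f x * (V * s ^ d)) / s ^ d"
        using s by (simp add: field_simps)
      ultimately have "\<bar>measure F (A s) / s ^ d - f x * V\<bar> \<le> e / 2"
        using s by (simp add: abs_divide pos_divide_le_eq)
      then show ?thesis using e by (simp add: dist_real_def)
    qed
    then show "\<forall>\<^sub>F s in at_right 0. dist (measure F (A s) / s ^ d) (f x * V) < e"
      unfolding eventually_at_right_field using \<eta>(1) L by (intro exI[of _ "\<eta> / L"]) auto
  qed
  have "measure F {} < measure F (B 0)"
  proof (rule measure_strict_mono_open)
    show "open {z. inner (z - x) u < 0 \<and> tip_height T u (z - x) < 0}"
      by (intro open_Collect_conj open_Collect_less continuous_intros)
    have "x - u \<in> {z. inner (z - x) u < 0 \<and> tip_height T u (z - x) < 0}"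
      using u by (simp add: tip_height_def dot_square_norm)
    then show "{z. inner (z - x) u < 0 \<and> tip_height T u (z - x) < 0} \<noteq> {}" by blast
  qed (use sets in \<open>auto simp: B_def\<close>)
  then have B0: "0 < measure F (B 0)" by simp
  have "((\<lambda>s. measure F (A s) / s ^ d * s ^ d) \<longlongrightarrow> f x * V * 0 ^ d) (at_right 0)"
    by (intro tendsto_mult limA tendsto_power tendsto_ident_at)
  then have "\<forall>\<^sub>F s in at_right 0. measure F (A s) / s ^ d * s ^ d < measure F (B 0)"
    by (rule order_tendstoD(2)) (simp only: zero_power[OF d] mult_zero_right B0)
  then have "\<forall>\<^sub>F s in at_right 0. measure F (A s) / s ^ d = half_depth T F x u s / s ^ d"
    using eventually_at_right_less[of "0::real"]
  proof eventually_elim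
    case (elim s)
    have "measure F (B 0) \<le> measure F (B s)"
      using elim sets by (intro finite_measure_mono) (auto simp: B_def sets_F)
    then show ?case
      using elim by (simp add: half_depth_def A_def[symmetric] B_def[symmetric])
  qed
  with limA have "((\<lambda>s. half_depth T F x u s / s ^ d) \<longlongrightarrow> f x * V) (at_right 0)"
    by (rule Lim_transform_eventually)
  then show ?thesis by (simp add: V_def d_def)
qed

section \<open>The depth function of a positive law\<close>

text \<open>Both branches are instances of the results on \<open>half_depth\<close>: the right one for \<open>u\<close>, the left one for
  \<open>- u\<close> at \<open>- s\<close>. Their limits agree because the half-space depth does not depend on the sign of \<open>u\<close>.\<close>

lemma valley_depth_fun:
  fixes F :: "'a::euclidean_space measure"
  assumes F: "positive_law F" and G: "positive_law G" and \<alpha>: "0 < \<alpha>" "\<alpha> < pi"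
    and u: "norm u = 1" and dim: "DIM('a) \<ge> 2"
  shows "valley G (depth_fun \<alpha> F x u) (halfspace_depth F x u)"
proof -
  interpret F: positive_law F by fact
  interpret G: positive_law G by fact
  define T where "T = tan (\<alpha> / 2)"
  have T: "T > 0" using half_angle_pos(3)[OF \<alpha>] by (simp add: T_def)
  have u': "norm (- u) = 1" using u by simp
  have zero: "depth_fun \<alpha> F x u 0 = 0"
    using depth_fun_eq_half_depth[OF \<alpha> u, of 0] F.half_depth_nonpos T by (simp add: T_def)
  have right: "depth_fun \<alpha> F x u s = half_depth T F x u s" if "s \<ge> 0" for s
    using depth_fun_eq_half_depth[OF \<alpha> u that] by (simp add: T_def)
  have left: "depth_fun \<alpha> F x u s = half_depth T F x (- u) (- s)" if "s \<le> 0" for s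
  proof (cases "s = 0")
    case True
    then show ?thesis using zero F.half_depth_nonpos[OF T] by simp
  next
    case False
    then show ?thesis
      using that depth_fun_uminus[of s \<alpha> F x u] depth_fun_eq_half_depth[OF \<alpha> u', of "- s" F x] by (simp add: T_def)
  qed
  show ?thesis
  proof
    show "continuous_on UNIV (depth_fun \<alpha> F x u)" by (rule F.continuous_depth_fun[OF \<alpha> u])
    show "depth_fun \<alpha> F x u 0 = 0" by (rule zero)
    show "depth_fun \<alpha> F x u s < depth_fun \<alpha> F x u s'" if "0 \<le> s" "s < s'" for s s'
      using that F.half_depth_strict_mono[OF T u dim that] by (simp add: right)
    show "depth_fun \<alpha> F x u s' < depth_fun \<alpha> F x u s" if "s < s'" "s' \<le> 0" for s s'
      using that F.half_depth_strict_mono[OF T u' dim, of "- s'" "- s"] by (simp add: left)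
    show "depth_fun \<alpha> F x u s < halfspace_depth F x u" for s
      using F.half_depth_less_halfspace_depth[OF T u dim, of s x]
        F.half_depth_less_halfspace_depth[OF T u' dim, of "- s" x]
      by (cases "s \<ge> 0") (simp_all add: right left halfspace_depth_uminus)
    show "\<exists>s\<ge>0. t < depth_fun \<alpha> F x u s" if t: "t < halfspace_depth F x u" for t
      using F.half_depth_exhausts[OF t, of T] by (auto simp: right)
    show "\<exists>s\<le>0. t < depth_fun \<alpha> F x u s" if "t < halfspace_depth F x u" for t
    proof -
      have "t < halfspace_depth F x (- u)" using that by (simp add: halfspace_depth_uminus)
      then obtain s where "s \<ge> 0" "t < half_depth T F x (- u) s"
        using F.half_depth_exhausts by blast
      then show ?thesis by (intro exI[of _ "- s"]) (simp add: left)
    qed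
  qed
qed

lemma (in valley) depth_quantile_eq_quantile:
  assumes "D = depth_fun \<alpha> F x u"
  shows "depth_quantile \<alpha> F G x u = quantile"
  by (simp add: fun_eq_iff depth_quantile_def quantile_def sublevel_mass_def depth_sublevel_def assms[symmetric])

lemma (in abs_cont_law) depth_quantile_degenerate:
  assumes "norm u = 1" and "DIM('a) \<ge> 2" and G: "prob_space G" "sets G = sets borel" and \<delta>: "\<delta> \<le> 1"
  shows "depth_quantile 0 F G x u \<delta> = 0"
proof -
  interpret G: prob_space G by fact
  have "measure G UNIV = 1"
    using G.prob_space sets_eq_imp_space_eq[OF G(2)] by simp
  then have "{t. t \<ge> 0 \<and> measure G (depth_sublevel 0 F x u t) \<ge> \<delta>} = {0..}"
    using \<delta> by (auto simp: depth_sublevel_def depth_fun_degenerate[OF assms(1,2)])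
  then show ?thesis by (simp add: depth_quantile_def)
qed

section \<open>Reversal of the direction\<close>

lemma measure_density_even:
  assumes g: "g \<in> borel_measurable borel" "\<And>s. g (- s) = g s" and S: "S \<in> sets borel"
  shows "measure (density lborel (\<lambda>s. ennreal (g s))) (uminus -` S) =
    measure (density lborel (\<lambda>s. ennreal (g s))) (S :: real set)"
proof -
  have [measurable]: "uminus -` S \<in> sets borel"
    using measurable_sets[of "uminus :: real \<Rightarrow> real" borel borel S] S by simp
  note g(1)[measurable] S[measurable]
  have "emeasure (density lborel (\<lambda>s. ennreal (g s))) S =
      (\<integral>\<^sup>+s. ennreal (g s) * indicator S s \<partial>lborel)"
    by (rule emeasure_density) auto
  also have "\<dots> = ennreal \<bar>-1\<bar> * (\<integral>\<^sup>+s. ennreal (g (0 + -1 * s)) * indicator S (0 + -1 * s) \<partial>lborel)"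
    by (rule nn_integral_real_affine) auto
  also have "\<dots> = (\<integral>\<^sup>+s. ennreal (g s) * indicator (uminus -` S) s \<partial>lborel)"
    by (simp add: g(2) indicator_def)
  also have "\<dots> = emeasure (density lborel (\<lambda>s. ennreal (g s))) (uminus -` S)"
    by (rule emeasure_density[symmetric]) auto
  finally show ?thesis by (simp add: measure_def)
qed

lemma (in abs_cont_law) depth_fun_uminus_direction:
  assumes "0 < \<alpha>" "\<alpha> < pi" "norm u = 1"
  shows "depth_fun \<alpha> F x (- u) s = depth_fun \<alpha> F x u (- s)"
proof -
  have "norm (- u) = 1" using assms by simp
  then show ?thesis
    using depth_fun_eq_sum[OF assms(1,2), of u x "- s"] depth_fun_eq_sum[OF assms(1,2), of "- u" x s] assms(3)
    by simp
qed

text \<open>Measurability matters for the image measures below: outside the Borel sets the measure of a set is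
  \<open>0\<close> by convention.\<close>

lemma (in abs_cont_law) sets_depth_sublevel:
  assumes "0 < \<alpha>" "\<alpha> < pi" "norm u = 1"
  shows "depth_sublevel \<alpha> F x u t \<in> sets borel"
  unfolding depth_sublevel_def
  by (intro borel_closed closed_Collect_le continuous_depth_fun[OF assms] continuous_on_const)

lemma (in abs_cont_law) depth_quantile_uminus:
  assumes \<alpha>: "0 < \<alpha>" "\<alpha> < pi" and u: "norm u = 1"
    and g: "g \<in> borel_measurable borel" "\<And>s. g (- s) = g s" and G: "G = density lborel (\<lambda>s. ennreal (g s))"
  shows "depth_quantile \<alpha> F G x (- u) \<delta> = depth_quantile \<alpha> F G x u \<delta>"
proof -
  have "depth_sublevel \<alpha> F x (- u) t = uminus -` depth_sublevel \<alpha> F x u t" for t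
    by (auto simp: depth_sublevel_def depth_fun_uminus_direction[OF \<alpha> u])
  then have "measure G (depth_sublevel \<alpha> F x (- u) t) = measure G (depth_sublevel \<alpha> F x u t)" for t
    unfolding G using measure_density_even[OF g sets_depth_sublevel[OF \<alpha> u]] by simp
  then show ?thesis by (simp add: depth_quantile_def)
qed

section \<open>Projection to the line and half-space depth\<close>

lemma (in abs_cont_law) cdf_line_proj:
  "cdf (line_proj F x u) 0 = measure F {z. inner (z - x) u \<le> 0}"
  "S \<in> sets borel \<Longrightarrow> measure (line_proj F x u) S = measure F {z. inner (z - x) u \<in> S}"
proof -
  have m: "(\<lambda>z. inner (z - x) u) \<in> borel_measurable F"
    unfolding measurable_cong_sets[OF sets_F refl]
    by (intro borel_measurable_continuous_onI continuous_intros)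
  show *: "measure (line_proj F x u) S = measure F {z. inner (z - x) u \<in> S}" if "S \<in> sets borel" for S
    using measure_distr[OF m that] by (simp add: line_proj_def space_F vimage_def)
  show "cdf (line_proj F x u) 0 = measure F {z. inner (z - x) u \<le> 0}"
    by (simp add: cdf_def *)
qed

lemma (in abs_cont_law) halfspace_depth_eq_cdf:
  assumes "u \<noteq> 0"
  shows "halfspace_depth F x u = min (cdf (line_proj F x u) 0) (1 - cdf (line_proj F x u) 0)"
  using measure_halfspaces[OF assms, of x] by (simp add: halfspace_depth_def cdf_line_proj min.commute)

lemma tukey_depth_real:
  "tukey_depth P (p :: real) = min (measure P {p..}) (measure P {..p})"
proof -
  have "sphere (0::real) 1 = {1, -1}" by (auto simp: abs_if split: if_splits)
  moreover have "{z. inner (z - p) 1 \<ge> 0} = {p..}" "{z. inner (z - p) (- 1) \<ge> 0} = {..p}" by auto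
  ultimately show ?thesis
    by (simp add: tukey_depth_def cInf_eq_Min)
qed

lemma (in abs_cont_law) tukey_depth_line_proj:
  "tukey_depth (line_proj F x u) 0 = halfspace_depth F x u"
  by (simp add: tukey_depth_real halfspace_depth_def cdf_line_proj(2))

section \<open>Invariance under similarities\<close>

text \<open>The similarity \<open>\<phi>\<close> preserves angles and multiplies lengths by \<open>\<sigma>\<close>, so the preimage of the cone with
  tip at \<open>\<sigma> * s\<close> is the cone with tip at \<open>s\<close>, and likewise for the two half-spaces.\<close>

lemma depth_fun_similarity:
  fixes F :: "(real ^ 'n) measure"
  assumes sets: "sets F = sets borel" and \<sigma>: "\<sigma> > 0" and Q: "orthogonal_matrix Q"
  shows "depth_fun \<alpha> (similarity_law \<mu> \<sigma> Q F) (\<sigma> *\<^sub>R (Q *v x) + \<mu>) (Q *v u) (\<sigma> * s) =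
    depth_fun \<alpha> F x u s"
proof -
  define \<phi> where "\<phi> y = \<sigma> *\<^sub>R (Q *v y) + \<mu>" for y
  have "orthogonal_transformation ((*v) Q)"
    using Q by (simp add: orthogonal_transformation_matrix matrix_vector_mul_linear)
  then have Qi: "inner (Q *v v) (Q *v w) = inner v w" and Qn: "norm (Q *v v) = norm v" for v w
    by (simp_all add: orthogonal_transformation_def norm_eq_sqrt_inner)
  have \<phi>d: "\<phi> z - \<phi> y = \<sigma> *\<^sub>R (Q *v (z - y))" for z y
    by (simp add: \<phi>_def matrix_vector_mult_diff_distrib scaleR_diff_right)
  have tip: "\<phi> x + (\<sigma> * s) *\<^sub>R (Q *v u) = \<phi> (x + s *\<^sub>R u)"
    by (simp add: \<phi>_def matrix_vector_right_distrib matrix_vector_mult_scaleR scaleR_add_right)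
  have half: "inner (\<phi> z - \<phi> y) (Q *v u) = \<sigma> * inner (z - y) u" for z y
    by (simp add: \<phi>d Qi)
  have cone: "\<phi> z \<in> cone \<alpha> (\<phi> x) (Q *v u) (\<sigma> * s) \<longleftrightarrow> z \<in> cone \<alpha> x u s" for z
  proof -
    define k where "k = inner (z - (x + s *\<^sub>R u)) u"
    define n where "n = norm (z - (x + s *\<^sub>R u))"
    have i: "inner (\<phi> z - \<phi> (x + s *\<^sub>R u)) (Q *v u) = \<sigma> * k"
      unfolding half k_def by simp
    have n: "norm (\<phi> z - \<phi> (x + s *\<^sub>R u)) = \<sigma> * n"
      unfolding \<phi>d using \<sigma> by (simp only: norm_scaleR Qn n_def abs_of_pos)
    have "cos (\<alpha> / 2) * (\<sigma> * n) \<le> - (\<sigma> * k) \<longleftrightarrow> cos (\<alpha> / 2) * n \<le> - k"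
      "cos (\<alpha> / 2) * (\<sigma> * n) \<le> \<sigma> * k \<longleftrightarrow> cos (\<alpha> / 2) * n \<le> k"
      using \<sigma> mult_le_cancel_left_pos[OF \<sigma>, of "cos (\<alpha> / 2) * n" "- k"]
        mult_le_cancel_left_pos[OF \<sigma>, of "cos (\<alpha> / 2) * n" k] by (simp_all add: mult_ac)
    moreover have "0 \<le> \<sigma> * s \<longleftrightarrow> 0 \<le> s" using \<sigma> by (simp add: zero_le_mult_iff)
    ultimately show ?thesis
      unfolding cone_def Let_def tip by (simp add: i n flip: k_def n_def)
  qed
  have sgn: "0 \<le> \<sigma> * s \<longleftrightarrow> 0 \<le> s" "\<And>k. 0 \<le> \<sigma> * k \<longleftrightarrow> 0 \<le> k" "\<And>k. \<sigma> * k \<le> 0 \<longleftrightarrow> k \<le> 0"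
    using \<sigma> by (simp_all add: zero_le_mult_iff mult_le_0_iff)
  have "\<phi> -` cone_A \<alpha> (\<phi> x) (Q *v u) (\<sigma> * s) = cone_A \<alpha> x u s"
    "\<phi> -` cone_B \<alpha> (\<phi> x) (Q *v u) (\<sigma> * s) = cone_B \<alpha> x u s"
    by (auto simp: cone_A_def cone_B_def cone half sgn split: if_splits)
  moreover have "measure (similarity_law \<mu> \<sigma> Q F) S = measure F (\<phi> -` S)" if "closed S" for S
  proof -
    have "\<phi> \<in> measurable F borel"
      unfolding measurable_cong_sets[OF sets refl] \<phi>_def
      by (intro borel_measurable_continuous_onI continuous_intros matrix_vector_mult_linear_continuous_on)
    then show ?thesis
      using that sets_eq_imp_space_eq[OF sets]
      unfolding similarity_law_def \<phi>_def[symmetric] by (simp add: measure_distr)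
  qed
  ultimately show ?thesis
    by (simp add: depth_fun_def closed_cone_A closed_cone_B flip: \<phi>_def)
qed

lemma depth_quantile_similarity:
  fixes F :: "(real ^ 'n) measure"
  assumes sets: "sets F = sets borel" "sets G = sets borel" and \<sigma>: "\<sigma> > 0" and Q: "orthogonal_matrix Q"
    and sub: "\<And>t. depth_sublevel \<alpha> F x u t \<in> sets borel"
  shows "depth_quantile \<alpha> (similarity_law \<mu> \<sigma> Q F) (scaled_law \<sigma> G) (\<sigma> *\<^sub>R (Q *v x) + \<mu>) (Q *v u) \<delta> =
    depth_quantile \<alpha> F G x u \<delta>"
proof -
  let ?S = "depth_sublevel \<alpha> (similarity_law \<mu> \<sigma> Q F) (\<sigma> *\<^sub>R (Q *v x) + \<mu>) (Q *v u)"
  have "measure (scaled_law \<sigma> G) (?S t) = measure G (depth_sublevel \<alpha> F x u t)" for t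
  proof -
    have pre: "(\<lambda>s. \<sigma> * s) -` ?S t = depth_sublevel \<alpha> F x u t"
      using depth_fun_similarity[OF sets(1) \<sigma> Q] by (auto simp: depth_sublevel_def)
    have "s \<in> ?S t \<longleftrightarrow> s / \<sigma> \<in> depth_sublevel \<alpha> F x u t" for s
      using \<sigma> unfolding pre[symmetric] by simp
    then have "?S t = (\<lambda>s. s / \<sigma>) -` depth_sublevel \<alpha> F x u t" by auto
    then have "?S t \<in> sets borel"
      using measurable_sets[of "\<lambda>s. s / \<sigma>" borel borel, OF _ sub[of t]] by simp
    moreover have "(\<lambda>s. \<sigma> * s) \<in> measurable G borel"
      unfolding measurable_cong_sets[OF sets(2) refl] by measurable
    ultimately show ?thesis
      using pre sets_eq_imp_space_eq[OF sets(2)] by (simp add: scaled_law_def measure_distr)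
  qed
  then show ?thesis by (simp add: depth_quantile_def)
qed

section \<open>The depth quantile function\<close>

lemma depth_quantile_small_scales:
  fixes F :: "(real ^ 'n) measure"
  assumes dim: "CARD('n) \<ge> 2" and \<alpha>: "0 < \<alpha>" "\<alpha> < pi" and u: "norm u = 1"
    and F: "prob_space F" and f: "f \<in> borel_measurable borel" "\<And>y. f y > 0" "F = density lborel (\<lambda>y. ennreal (f y))"
    and G: "prob_space G" and g: "g \<in> borel_measurable borel" "\<And>s. g s > 0" "G = density lborel (\<lambda>s. ennreal (g s))"
    and lp: "lebesgue_point f x" "lebesgue_point g 0"
  shows "((\<lambda>\<delta>. depth_quantile \<alpha> F G x u \<delta> / \<delta> ^ CARD('n)) \<longlongrightarrow>
    small_scale_const \<alpha> CARD('n) * (f x / g 0 ^ CARD('n))) (at_right 0)"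
proof -
  interpret F: positive_law F using F f(1,3,2) by (rule positive_law_density)
  interpret G: positive_law G using G g(1,3,2) by (rule positive_law_density)
  interpret valley G "depth_fun \<alpha> F x u" "halfspace_depth F x u"
    using dim by (intro valley_depth_fun F.positive_law_axioms G.positive_law_axioms \<alpha> u) simp
  define d where "d = CARD('n)"
  define T where "T = tan (\<alpha> / 2)"
  have T: "T > 0" using half_angle_pos(3)[OF \<alpha>] by (simp add: T_def)
  define c where "c = f x * (unit_ball_vol (real (d - 1)) * T ^ (d - 1) / real d)"
  have d: "d > 0" by (simp add: d_def)
  have c: "c > 0" using f(2) T d by (simp add: c_def)
  have near0: "((\<lambda>s. half_depth T F x v s / s ^ d) \<longlongrightarrow> c) (at_right 0)" if "norm v = 1" for v
    using half_depth_asymptotics[OF F f lp(1) T that] by (simp add: c_def d_def)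
  have "((\<lambda>\<delta>. quantile \<delta> / \<delta> ^ d) \<longlongrightarrow> c / (2 * g 0) ^ d) (at_right 0)"
  proof (rule quantile_asymptotics[OF d g(2)])
    show "((\<lambda>s. depth_fun \<alpha> F x u s / s ^ d) \<longlongrightarrow> c) (at_right 0)"
    proof (rule Lim_transform_eventually[OF near0[OF u]])
      show "\<forall>\<^sub>F s in at_right 0. half_depth T F x u s / s ^ d = depth_fun \<alpha> F x u s / s ^ d"
        using eventually_at_right_less[of "0::real"]
        by eventually_elim (simp add: depth_fun_eq_half_depth[OF \<alpha> u] T_def)
    qed
    have u': "norm (- u) = 1" using u by simp
    show "((\<lambda>s. depth_fun \<alpha> F x u (- s) / s ^ d) \<longlongrightarrow> c) (at_right 0)"
    proof (rule Lim_transform_eventually[OF near0[OF u']])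
      show "\<forall>\<^sub>F s in at_right 0. half_depth T F x (- u) s / s ^ d = depth_fun \<alpha> F x u (- s) / s ^ d"
        using eventually_at_right_less[of "0::real"]
        by eventually_elim (simp add: depth_fun_uminus depth_fun_eq_half_depth[OF \<alpha> u'] T_def)
    qed
    show "c > 0" by (rule c)
    fix \<epsilon> :: real assume "\<epsilon> > 0"
    then obtain \<eta> where \<eta>: "\<eta> > 0" "\<And>r S. 0 < r \<Longrightarrow> r < \<eta> \<Longrightarrow> S \<in> sets borel \<Longrightarrow> S \<subseteq> ball 0 r \<Longrightarrow>
        \<bar>(LINT y:S|lborel. g y) - g 0 * measure lborel S\<bar> \<le> \<epsilon> * r"
      using lebesgue_point_small_sets[OF prob_density_lborel(1)[OF G g(1) _ g(3)] lp(2), of \<epsilon>] g(2)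
      by (auto simp: less_imp_le)
    have "\<bar>measure G {a..b} - g 0 * (b - a)\<bar> \<le> \<epsilon> * (b - a)" if "a < 0" "0 < b" "b - a < \<eta>" for a b
      using that \<eta>(2)[of "b - a" "{a..b}"] prob_density_lborel(2)[OF G g(1) _ g(3), of "{a..b}"] g(2)
      by (force simp: less_imp_le dist_real_def)
    then show "\<exists>\<eta>>0. \<forall>a b. a < 0 \<longrightarrow> 0 < b \<longrightarrow> b - a < \<eta> \<longrightarrow>
        \<bar>measure G {a..b} - g 0 * (b - a)\<bar> \<le> \<epsilon> * (b - a)"
      using \<eta>(1) by blast
  qed
  moreover have "c / (2 * g 0) ^ d = small_scale_const \<alpha> d * (f x / g 0 ^ d)"
    by (simp add: c_def small_scale_const_def T_def power_mult_distrib mult_ac)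
  ultimately show ?thesis by (simp add: depth_quantile_eq_quantile d_def)
qed

theorem lemma2p2:
  fixes \<alpha> :: real
    and F :: "(real ^ 'n) measure" and f :: "real ^ 'n \<Rightarrow> real"
    and G :: "real measure"
    and x u :: "real ^ 'n"
  assumes dim: "CARD('n) \<ge> 2"
    and angle: "0 \<le> \<alpha>" "\<alpha> < pi"
    and F: "prob_space F"
    and f: "f \<in> borel_measurable borel" "\<forall>y. f y \<ge> 0" "F = density lborel (\<lambda>y. ennreal (f y))"
    and G: "prob_space G" "sets G = sets borel"
    and u: "norm u = 1"
  shows
    "(\<forall>g :: real \<Rightarrow> real.
        (\<forall>y. f y > 0) \<and> g \<in> borel_measurable borel \<and> (\<forall>s. g s > 0) \<and>
        G = density lborel (\<lambda>s. ennreal (g s)) \<longrightarrow>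
        \<comment> \<open>(a)\<close>
        (\<alpha> > 0 \<longrightarrow>
          (\<forall>\<delta>\<in>{0<..<1}. \<exists>sl sr. sl \<le> sr \<and>
             depth_sublevel \<alpha> F x u (depth_quantile \<alpha> F G x u \<delta>) = {sl..sr} \<and>
             depth_quantile \<alpha> F G x u \<delta> = depth_fun \<alpha> F x u sl \<and>
             depth_quantile \<alpha> F G x u \<delta> = depth_fun \<alpha> F x u sr) \<and>
          strict_mono_on {0..1} (depth_quantile \<alpha> F G x u)) \<and>
        depth_quantile \<alpha> F G x u 0 = 0 \<and>
        ((\<forall>s. g (- s) = g s) \<longrightarrow>
          (\<forall>\<delta>\<in>{0..1}. depth_quantile \<alpha> F G x u \<delta> = depth_quantile \<alpha> F G x (- u) \<delta>)) \<and>
        \<comment> \<open>(b)\<close>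
        (\<alpha> > 0 \<longrightarrow>
          depth_quantile \<alpha> F G x u 1 =
            min (cdf (line_proj F x u) 0) (1 - cdf (line_proj F x u) 0)) \<and>
        min (cdf (line_proj F x u) 0) (1 - cdf (line_proj F x u) 0) =
          tukey_depth (line_proj F x u) 0 \<and>
        \<comment> \<open>(c)\<close>
        (\<alpha> > 0 \<longrightarrow> small_scale_const \<alpha> CARD('n) > 0) \<and>
        (lebesgue_point f x \<and> lebesgue_point g 0 \<longrightarrow>
          ((\<lambda>\<delta>. depth_quantile \<alpha> F G x u \<delta> / \<delta> ^ CARD('n)) \<longlongrightarrow>
             small_scale_const \<alpha> CARD('n) * (f x / g 0 ^ CARD('n))) (at_right 0))) \<and>
     \<comment> \<open>(d)\<close>
     (\<forall>\<mu> \<sigma> (Q :: real ^ 'n ^ 'n). \<sigma> > 0 \<and> orthogonal_matrix Q \<longrightarrow>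
        (\<forall>\<delta>\<in>{0..1}.
           depth_quantile \<alpha> (similarity_law \<mu> \<sigma> Q F) (scaled_law \<sigma> G)
             (\<sigma> *\<^sub>R (Q *v x) + \<mu>) (Q *v u) \<delta> =
           depth_quantile \<alpha> F G x u \<delta>))"
proof (intro conjI allI impI)
  interpret F: abs_cont_law F using F f(1,3) by (rule abs_cont_law_density)
  have dim': "DIM(real ^ 'n) \<ge> 2" using dim by simp
  have u0: "u \<noteq> 0" using u by auto
  have u': "norm (- u) = 1" using u by simp
  {
    fix \<mu> and \<sigma> :: real and Q :: "real ^ 'n ^ 'n"
    assume "\<sigma> > 0 \<and> orthogonal_matrix Q"
    then have \<sigma>Q: "\<sigma> > 0" "orthogonal_matrix Q" by auto
    have "depth_sublevel \<alpha> F x u t \<in> sets borel" for t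
    proof (cases "\<alpha> = 0")
      case True
      then show ?thesis by (simp add: depth_sublevel_def F.depth_fun_degenerate[OF u dim'])
    next
      case False
      then show ?thesis using angle u by (intro F.sets_depth_sublevel) auto
    qed
    then show "\<forall>\<delta>\<in>{0..1}. depth_quantile \<alpha> (similarity_law \<mu> \<sigma> Q F) (scaled_law \<sigma> G)
             (\<sigma> *\<^sub>R (Q *v x) + \<mu>) (Q *v u) \<delta> = depth_quantile \<alpha> F G x u \<delta>"
      using depth_quantile_similarity[OF F.sets_F G(2) \<sigma>Q] by blast
  }
  fix g :: "real \<Rightarrow> real"
  assume "(\<forall>y. f y > 0) \<and> g \<in> borel_measurable borel \<and> (\<forall>s. g s > 0) \<and>
        G = density lborel (\<lambda>s. ennreal (g s))"
  then have fp: "\<And>y. f y > 0" and g: "g \<in> borel_measurable borel" "\<And>s. g s > 0"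
      "G = density lborel (\<lambda>s. ennreal (g s))" by auto
  have PF: "positive_law F" using F f(1,3) fp by (rule positive_law_density)
  have PG: "positive_law G" using G(1) g(1,3,2) by (rule positive_law_density)
  have V: "valley G (depth_fun \<alpha> F x u) (halfspace_depth F x u)" if "\<alpha> > 0"
    by (rule valley_depth_fun[OF PF PG that angle(2) u dim'])
  note eq_quantile = valley.depth_quantile_eq_quantile[OF V refl]
  note degenerate = F.depth_quantile_degenerate[OF _ dim' G]
  {
    assume \<alpha>: "\<alpha> > 0"
    interpret valley G "depth_fun \<alpha> F x u" "halfspace_depth F x u" by (rule V[OF \<alpha>])
    show "\<forall>\<delta>\<in>{0<..<1}. \<exists>sl sr. sl \<le> sr \<and>
             depth_sublevel \<alpha> F x u (depth_quantile \<alpha> F G x u \<delta>) = {sl..sr} \<and>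
             depth_quantile \<alpha> F G x u \<delta> = depth_fun \<alpha> F x u sl \<and>
             depth_quantile \<alpha> F G x u \<delta> = depth_fun \<alpha> F x u sr"
    proof
      fix \<delta> :: real assume "\<delta> \<in> {0<..<1}"
      then obtain a b where "a < 0" "0 < b" "{s. depth_fun \<alpha> F x u s \<le> quantile \<delta>} = {a..b}"
          "depth_fun \<alpha> F x u a = quantile \<delta>" "depth_fun \<alpha> F x u b = quantile \<delta>"
        using quantile_interval[of \<delta>] by auto
      then show "\<exists>sl sr. sl \<le> sr \<and>
             depth_sublevel \<alpha> F x u (depth_quantile \<alpha> F G x u \<delta>) = {sl..sr} \<and>
             depth_quantile \<alpha> F G x u \<delta> = depth_fun \<alpha> F x u sl \<and>
             depth_quantile \<alpha> F G x u \<delta> = depth_fun \<alpha> F x u sr"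
        unfolding depth_quantile_eq_quantile[OF refl] depth_sublevel_def
        by (intro exI[of _ a] exI[of _ b]) auto
    qed
    show "strict_mono_on {0..1} (depth_quantile \<alpha> F G x u)"
      unfolding depth_quantile_eq_quantile[OF refl] by (rule quantile_strict_mono)
    show "depth_quantile \<alpha> F G x u 1 = min (cdf (line_proj F x u) 0) (1 - cdf (line_proj F x u) 0)"
      unfolding depth_quantile_eq_quantile[OF refl] quantile_1 by (rule F.halfspace_depth_eq_cdf[OF u0])
    show "small_scale_const \<alpha> CARD('n) > 0"
      using half_angle_pos(3)[OF \<alpha> angle(2)] by (simp add: small_scale_const_def)
  }
  show "min (cdf (line_proj F x u) 0) (1 - cdf (line_proj F x u) 0) = tukey_depth (line_proj F x u) 0"
    by (simp add: F.tukey_depth_line_proj F.halfspace_depth_eq_cdf[OF u0])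
  show "depth_quantile \<alpha> F G x u 0 = 0"
    using degenerate[OF u] valley.quantile_0[OF V] eq_quantile angle by (cases "\<alpha> = 0") auto
  {
    assume even: "\<forall>s. g (- s) = g s"
    show "\<forall>\<delta>\<in>{0..1}. depth_quantile \<alpha> F G x u \<delta> = depth_quantile \<alpha> F G x (- u) \<delta>"
    proof (cases "\<alpha> = 0")
      case True
      then show ?thesis using degenerate[OF u] degenerate[OF u'] by simp
    next
      case False
      then show ?thesis
        using F.depth_quantile_uminus[OF _ angle(2) u g(1) _ g(3)] even angle by auto
    qed
  }
  assume lp: "lebesgue_point f x \<and> lebesgue_point g 0"
  show "((\<lambda>\<delta>. depth_quantile \<alpha> F G x u \<delta> / \<delta> ^ CARD('n)) \<longlongrightarrow>
             small_scale_const \<alpha> CARD('n) * (f x / g 0 ^ CARD('n))) (at_right 0)"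
  proof (cases "\<alpha> = 0")
    case True
    \<comment> \<open>Both sides vanish for \<open>\<alpha> = 0\<close>: the quantile function does, and \<open>tan 0 ^ (d - 1) = 0\<close> because \<open>d \<ge> 2\<close>.\<close>
    have "\<forall>\<^sub>F \<delta> in at_right 0. 0 = depth_quantile \<alpha> F G x u \<delta> / \<delta> ^ CARD('n)"
      unfolding eventually_at_right_field using degenerate[OF u] True by (intro exI[of _ 1]) auto
    moreover have "small_scale_const \<alpha> CARD('n) = 0"
      using True dim by (simp add: small_scale_const_def)
    ultimately show ?thesis by (intro Lim_transform_eventually[OF tendsto_const]) simp_all
  next
    case False
    then show ?thesis
      using depth_quantile_small_scales[OF dim _ angle(2) u F f(1) fp f(3) G(1) g] lp angle by auto
  qed
qed

end
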